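(* Let $\mathcal X=(\Omega,S)$ and $\mathcal X'=(\Omega',S')$ be coherent configurations, let $m\ge 2$, and let $\varphi$ be an algebraic isomorphism from $\mathcal X$ to $\mathcal X'$. Then $\mathcal X$ and $\mathcal X'$ are $\mathrm{WL}_m$-equivalent with respect to $\varphi$ if and only if the binary relation $T^m_\varphi(\mathcal X,\mathcal X')\subseteq \Omega^m\times\Omega'^m$ has full support, i.e., every $x\in\Omega^m$ occurs as the first coordinate of some pair in $T^m_\varphi(\mathcal X,\mathcal X')$ and every $x'\in\Omega'^m$ occurs as the second coordinate of some pair in it.
   Context: A coherent configuration on a finite set $\Omega$ is a pair $(\Omega,S)$, $S$ a partition of $\Omega\times\Omega$, such that the diagonal $1_\Omega$ is a union of elements of $S$; $s^*=\{(\beta,\alpha):(\alpha,\beta)\in s\}\in S$ for $s\in S$; and for $r,s,t\in S$ the number $c^t_{rs}=|\{\gamma:(\alpha,\gamma)\in r,(\gamma,\beta)\in s\}|$ does not depend on $(\alpha,\beta)\in t$. An algebraic isomorphism $\mathcal X\to\mathcal X'$ is a bijection $\varphi:S\to S'$ with $c^{\varphi(t)}_{\varphi(r)\varphi(s)}=c^t_{rs}$ for all $r,s,t$; it extends to unions of basis relations. For $\Delta\subseteq\Omega$ and $s\in S$ put $s_\Delta=s\cap(\Delta\times\Delta)$. $m$-ary coherent configurations: for $x\in\Omega^m$ and a map $\sigma:M\to M$, $M=\{1,\dots,m\}$, put $x^\sigma=(x_{1^\sigma},\dots,x_{m^\sigma})$; let $\rho(x)$ be the equivalence relation $\{(i,j):x_i=x_j\}$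 on $M$; $x_{i\leftarrow\alpha}$ is $x$ with $i$-th entry replaced by $\alpha$. A partition $\mathfrak X$ of $\Omega^m$ is an $m$-ary coherent configuration if for every class $X$: $\rho(x)$ is constant on $X$; $X^\sigma\in\mathfrak X$ for all $\sigma:M\to M$; and for $X_0,\dots,X_m\in\mathfrak X$ the number of $\alpha\in\Omega$ with $x_{i\leftarrow\alpha}\in X_i$ for all $i$ (denoted $n^{X_0}_{X_1,\dots,X_m}$) does not depend on $x\in X_0$. An algebraic isomorphism of $m$-ary coherent configurations $\mathfrak X\to\mathfrak X'$ is a bijection $\hat\varphi$ between the classes with $\hat\varphi(X^\sigma)=\hat\varphi(X)^\sigma$ and $n^{X_0}_{X_1,\dots,X_m}=n^{\hat\varphi(X_0)}_{\hat\varphi(X_1),\dots,\hat\varphi(X_m)}$ for all classes and all $\sigma$. Its $2$-projection $\hat\varphi_2$ maps $\mathrm{pr}_2X\mapsto\mathrm{pr}_2\hat\varphi(X)$, where $\mathrm{pr}_2X=\{(x_1,x_2):x\in X\}$ (the sets $\mathrm{pr}_2X$ form a coherent configuration). $\mathrm{WL}_m(\mathcal X)$ denotes the $m$-ary coherent configuration on $\Omega$ produced by the $m$-dimensional Weisfeiler–Leman algorithm applied to $\mathcal X$ (the partition of $\Omega^m$ into the classes of the stable coloring of $m$-tuples); every $s\in S$ is a union of classes of its $2$-projection. $\mathcal X$ and $\mathcal X'$ are $\mathrm{WL}_m$-equivalent with respect to $\varphi$ if there is an algebraic isomorphism $\hat\varphi:\mathrm{WL}_m(\mathcal X)\to\mathrm{WL}_m(\mathcal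 X')$ with $\hat\varphi_2(s)=\varphi(s)$ for all $s\in S$. Pebble game $\mathsf C_{k}(\varphi)$ on $\mathcal X,\mathcal X'$: two players Spoiler and Duplicator, $k$ distinct pebbles each in two copies. Each round: Spoiler chooses a set $A'$ of points in $\Omega$ or in $\Omega'$; Duplicator answers with a set $A$ of the same size in the other set (if impossible, Duplicator loses); Spoiler places (or moves) one pebble on a point of $A$; Duplicator places its copy on a point of $A'$. Several pebbles may lie on the same point. After a round, let $\Delta\subseteq\Omega$, $\Delta'\subseteq\Omega'$ be the pebbled points and $f:\Delta\to\Delta'$ map each point to the point covered by the copy of the same pebble; Duplicator wins the round if $f$ is a well-defined bijection with $(s_\Delta)^f=\varphi(s)_{\Delta'}$ for all $s\in S$ with $s_\Delta\neq\varnothing$. An initial configuration is a pair $(x,x')\in\Omega^j\times\Omega'^j$, $j\le k$, where $x_i$ and $x'_i$ are covered by copies of the same pebble. Duplicator has a winning strategy from $(x,x')$ if, whatever Spoiler does, Duplicator wins after any number of rounds (including zero). $T^m_\varphi(\mathcal X,\mathcal X')$ is the set of pairs $(x,x')\in\Omega^m\times\Omega'^m$ such that Duplicator has a winning strategy in $\mathsf C_{m+1}(\varphi)$ with initial configuration $(x,x')$.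
   Formalization: In each round Spoiler fixes which pebble he will place or move before the sets are chosen, so Duplicator's set may depend on it; if he named it only afterwards the claim fails (m = 2, 4×4 rook's graph and Shrikhande graph). *)

theory Defs
  imports Main "HOL-Library.Multiset" "HOL-Library.Disjoint_Sets" "HOL-Library.FuncSet"
begin

section \<open>Coherent configurations\<close>

definition coherent_configuration :: "'a set \<Rightarrow> ('a \<times> 'a) set set \<Rightarrow> bool" where
  "coherent_configuration \<Omega> S \<longleftrightarrow>
     finite \<Omega> \<and>
     partition_on (\<Omega> \<times> \<Omega>) S \<and>
     (\<exists>D\<subseteq>S. Id_on \<Omega> = \<Union>D) \<and>
     (\<forall>s\<in>S. s\<inverse> \<in> S) \<and>
     (\<forall>r\<in>S. \<forall>s\<in>S. \<forall>t\<in>S. \<exists>c. \<forall>(\<alpha>, \<beta>)\<in>t.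
        card {\<gamma>\<in>\<Omega>. (\<alpha>, \<gamma>) \<in> r \<and> (\<gamma>, \<beta>) \<in> s} = c)"

definition intersection_number ::
    "'a set \<Rightarrow> ('a \<times> 'a) set \<Rightarrow> ('a \<times> 'a) set \<Rightarrow> ('a \<times> 'a) set \<Rightarrow> nat" where
  "intersection_number \<Omega> r s t =
     (THE c. \<forall>(\<alpha>, \<beta>)\<in>t. card {\<gamma>\<in>\<Omega>. (\<alpha>, \<gamma>) \<in> r \<and> (\<gamma>, \<beta>) \<in> s} = c)"

definition algebraic_isomorphism ::
    "'a set \<Rightarrow> ('a \<times> 'a) set set \<Rightarrow> 'b set \<Rightarrow> ('b \<times> 'b) set set
      \<Rightarrow> (('a \<times> 'a) set \<Rightarrow> ('b \<times> 'b) set) \<Rightarrow> bool" where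
  "algebraic_isomorphism \<Omega> S \<Omega>' S' \<phi> \<longleftrightarrow>
     bij_betw \<phi> S S' \<and>
     (\<forall>r\<in>S. \<forall>s\<in>S. \<forall>t\<in>S.
        intersection_number \<Omega>' (\<phi> r) (\<phi> s) (\<phi> t) = intersection_number \<Omega> r s t)"


section \<open>Coherent configurations of higher arity\<close>

text \<open>
  An \<open>m\<close>-tuple is a list of length \<open>m\<close>; its positions are \<open>0, \<dots>, m - 1\<close>, and
  replacing the \<open>i\<close>-th entry by \<open>\<alpha>\<close> is the list update \<open>x[i := \<alpha>]\<close>.
\<close>

definition tuples :: "'a set \<Rightarrow> nat \<Rightarrow> 'a list set" where
  "tuples \<Omega> m = {x. length x = m \<and> set x \<subseteq> \<Omega>}"

definition reindex :: "(nat \<Rightarrow> nat) \<Rightarrow> 'a list \<Rightarrow> 'a list" where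
  "reindex \<sigma> x = map (\<lambda>i. x ! \<sigma> i) [0..<length x]"

definition eq_pattern :: "'a list \<Rightarrow> (nat \<times> nat) set" where
  "eq_pattern x = {(i, j). i < length x \<and> j < length x \<and> x ! i = x ! j}"

definition extension_count :: "'a set \<Rightarrow> 'a list set list \<Rightarrow> 'a list \<Rightarrow> nat" where
  "extension_count \<Omega> Xs x = card {\<alpha>\<in>\<Omega>. \<forall>i<length Xs. x[i := \<alpha>] \<in> Xs ! i}"

definition mary_coherent_configuration :: "nat \<Rightarrow> 'a set \<Rightarrow> 'a list set set \<Rightarrow> bool" where
  "mary_coherent_configuration m \<Omega> \<X> \<longleftrightarrow>
     finite \<Omega> \<and>
     partition_on (tuples \<Omega> m) \<X> \<and>
     (\<forall>X\<in>\<X>. \<forall>x\<in>X. \<forall>y\<in>X. eq_pattern x = eq_pattern y) \<and>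
     (\<forall>X\<in>\<X>. \<forall>\<sigma> \<in> {..<m} \<rightarrow> {..<m}. reindex \<sigma> ` X \<in> \<X>) \<and>
     (\<forall>X\<^sub>0\<in>\<X>. \<forall>Xs\<in>tuples \<X> m. \<exists>c. \<forall>x\<in>X\<^sub>0. extension_count \<Omega> Xs x = c)"

definition mary_intersection_number ::
    "'a set \<Rightarrow> 'a list set \<Rightarrow> 'a list set list \<Rightarrow> nat" where
  "mary_intersection_number \<Omega> X\<^sub>0 Xs = (THE c. \<forall>x\<in>X\<^sub>0. extension_count \<Omega> Xs x = c)"

definition mary_algebraic_isomorphism ::
    "nat \<Rightarrow> 'a set \<Rightarrow> 'a list set set \<Rightarrow> 'b set \<Rightarrow> 'b list set set
      \<Rightarrow> ('a list set \<Rightarrow> 'b list set) \<Rightarrow> bool" where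
  "mary_algebraic_isomorphism m \<Omega> \<X> \<Omega>' \<X>' \<psi> \<longleftrightarrow>
     mary_coherent_configuration m \<Omega> \<X> \<and>
     mary_coherent_configuration m \<Omega>' \<X>' \<and>
     bij_betw \<psi> \<X> \<X>' \<and>
     (\<forall>X\<in>\<X>. \<forall>\<sigma> \<in> {..<m} \<rightarrow> {..<m}. \<psi> (reindex \<sigma> ` X) = reindex \<sigma> ` \<psi> X) \<and>
     (\<forall>X\<^sub>0\<in>\<X>. \<forall>Xs\<in>tuples \<X> m.
        mary_intersection_number \<Omega> X\<^sub>0 Xs = mary_intersection_number \<Omega>' (\<psi> X\<^sub>0) (map \<psi> Xs))"

definition pr2 :: "'a list set \<Rightarrow> ('a \<times> 'a) set" where
  "pr2 X = (\<lambda>x. (x ! 0, x ! 1)) ` X"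

definition two_projection ::
    "'a list set set \<Rightarrow> ('a list set \<Rightarrow> 'b list set) \<Rightarrow> ('a \<times> 'a) set \<Rightarrow> ('b \<times> 'b) set" where
  "two_projection \<X> \<psi> u = (THE v. \<exists>X\<in>\<X>. pr2 X = u \<and> pr2 (\<psi> X) = v)"

definition extend_to_unions ::
    "('a \<times> 'a) set set \<Rightarrow> (('a \<times> 'a) set \<Rightarrow> ('b \<times> 'b) set) \<Rightarrow> ('a \<times> 'a) set \<Rightarrow> ('b \<times> 'b) set" where
  "extend_to_unions P f s = \<Union>(f ` {u\<in>P. u \<subseteq> s})"


section \<open>The multidimensional Weisfeiler--Leman algorithm\<close>

datatype 'c colour = Initial 'c | Refined "'c colour" "'c colour list multiset"

text \<open>
  The initial colour of a tuple is its equality pattern together with the basis relations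
  containing its pairs of entries. A refinement round adjoins to the colour of \<open>x\<close> the multiset,
  over all points \<open>\<alpha>\<close>, of the tuples of colours of \<open>x[i := \<alpha>]\<close>.
\<close>

primrec wl_colour ::
    "'a set \<Rightarrow> ('a \<times> 'a) set set \<Rightarrow> nat \<Rightarrow> 'a list
      \<Rightarrow> ((nat \<times> nat) set \<times> (nat \<times> nat \<times> ('a \<times> 'a) set) set) colour" where
  "wl_colour \<Omega> S 0 x =
     Initial (eq_pattern x,
       {(i, j, s). i < length x \<and> j < length x \<and> s \<in> S \<and> (x ! i, x ! j) \<in> s})"
| "wl_colour \<Omega> S (Suc n) x =
     Refined (wl_colour \<Omega> S n x)
       {# map (\<lambda>i. wl_colour \<Omega> S n (x[i := \<alpha>])) [0..<length x]. \<alpha> \<in># mset_set \<Omega> #}"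

definition stable_round :: "nat \<Rightarrow> 'a set \<Rightarrow> ('a \<times> 'a) set set \<Rightarrow> nat" where
  "stable_round m \<Omega> S =
     (LEAST n. \<forall>x\<in>tuples \<Omega> m. \<forall>y\<in>tuples \<Omega> m.
        wl_colour \<Omega> S n x = wl_colour \<Omega> S n y \<longleftrightarrow>
        wl_colour \<Omega> S (Suc n) x = wl_colour \<Omega> S (Suc n) y)"

definition WL :: "nat \<Rightarrow> 'a set \<Rightarrow> ('a \<times> 'a) set set \<Rightarrow> 'a list set set" where
  "WL m \<Omega> S =
     (let c = wl_colour \<Omega> S (stable_round m \<Omega> S)
      in (\<lambda>x. {y\<in>tuples \<Omega> m. c y = c x}) ` tuples \<Omega> m)"

definition WL_equivalent ::
    "nat \<Rightarrow> 'a set \<Rightarrow> ('a \<times> 'a) set set \<Rightarrow> 'b set \<Rightarrow> ('b \<times> 'b) set set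
      \<Rightarrow> (('a \<times> 'a) set \<Rightarrow> ('b \<times> 'b) set) \<Rightarrow> bool" where
  "WL_equivalent m \<Omega> S \<Omega>' S' \<phi> \<longleftrightarrow>
     (\<exists>\<psi>. mary_algebraic_isomorphism m \<Omega> (WL m \<Omega> S) \<Omega>' (WL m \<Omega>' S') \<psi> \<and>
        (\<forall>s\<in>S. extend_to_unions (pr2 ` WL m \<Omega> S) (two_projection (WL m \<Omega> S) \<psi>) s = \<phi> s))"


section \<open>The pebble game\<close>

text \<open>
  A position assigns to each pebble on the board the pair of points covered by its two copies.
\<close>

type_synonym ('a, 'b) position = "nat \<Rightarrow> ('a \<times> 'b) option"

text \<open>
  \<open>Round1 i A' A b a\<close>: Spoiler takes pebble \<open>i\<close> and chooses \<open>A' \<subseteq> \<Omega>\<close>, Duplicator answers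
  \<open>A \<subseteq> \<Omega>'\<close>, Spoiler puts pebble \<open>i\<close> on \<open>b \<in> A\<close>, Duplicator puts its copy on \<open>a \<in> A'\<close>.
  \<open>Round2\<close> is the same with the two sides exchanged. As usual in the counting game, the pebble
  to be placed or moved is known to Duplicator when she chooses \<open>A\<close>. If Spoiler named it only
  afterwards, then he would win the 3-pebble game on the strongly regular \<open>4 \<times> 4\<close> rook's graph
  and Shrikhande graph (three pebbles on a triangle inside a 4-clique, \<open>A'\<close> the fourth vertex),
  although these have the same intersection numbers.
\<close>

datatype ('a, 'b) round =
    Round1 nat "'a set" "'b set" 'b 'a
  | Round2 nat "'b set" "'a set" 'a 'b

text \<open>Histories list the rounds played so far, the most recent one first.\<close>

primrec position_after ::
    "('a, 'b) position \<Rightarrow> ('a, 'b) round list \<Rightarrow> ('a, 'b) position" where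
  "position_after p [] = p"
| "position_after p (r # h) =
     (case r of
        Round1 i A' A b a \<Rightarrow> (position_after p h)(i \<mapsto> (a, b))
      | Round2 i A' A a b \<Rightarrow> (position_after p h)(i \<mapsto> (a, b)))"

record ('a, 'b) strategy =
  set1 :: "('a, 'b) round list \<Rightarrow> nat \<Rightarrow> 'a set \<Rightarrow> 'b set"
  point1 :: "('a, 'b) round list \<Rightarrow> nat \<Rightarrow> 'a set \<Rightarrow> 'b \<Rightarrow> 'a"
  set2 :: "('a, 'b) round list \<Rightarrow> nat \<Rightarrow> 'b set \<Rightarrow> 'a set"
  point2 :: "('a, 'b) round list \<Rightarrow> nat \<Rightarrow> 'b set \<Rightarrow> 'a \<Rightarrow> 'b"

inductive_set plays ::
    "nat \<Rightarrow> 'a set \<Rightarrow> 'b set \<Rightarrow> ('a, 'b) strategy \<Rightarrow> ('a, 'b) round list set"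
  for k :: nat and \<Omega> :: "'a set" and \<Omega>' :: "'b set" and D :: "('a, 'b) strategy" where
  start: "[] \<in> plays k \<Omega> \<Omega>' D"
| round1: "\<lbrakk>h \<in> plays k \<Omega> \<Omega>' D; i < k; A' \<subseteq> \<Omega>; b \<in> set1 D h i A'\<rbrakk>
    \<Longrightarrow> Round1 i A' (set1 D h i A') b (point1 D h i A' b) # h \<in> plays k \<Omega> \<Omega>' D"
| round2: "\<lbrakk>h \<in> plays k \<Omega> \<Omega>' D; i < k; A' \<subseteq> \<Omega>'; a \<in> set2 D h i A'\<rbrakk>
    \<Longrightarrow> Round2 i A' (set2 D h i A') a (point2 D h i A' a) # h \<in> plays k \<Omega> \<Omega>' D"

definition legal_after ::
    "nat \<Rightarrow> 'a set \<Rightarrow> 'b set \<Rightarrow> ('a, 'b) strategy \<Rightarrow> ('a, 'b) round list \<Rightarrow> bool" where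
  "legal_after k \<Omega> \<Omega>' D h \<longleftrightarrow>
     (\<forall>i<k. \<forall>A'\<subseteq>\<Omega>. set1 D h i A' \<subseteq> \<Omega>' \<and> card (set1 D h i A') = card A' \<and>
        (\<forall>b\<in>set1 D h i A'. point1 D h i A' b \<in> A')) \<and>
     (\<forall>i<k. \<forall>A'\<subseteq>\<Omega>'. set2 D h i A' \<subseteq> \<Omega> \<and> card (set2 D h i A') = card A' \<and>
        (\<forall>a\<in>set2 D h i A'. point2 D h i A' a \<in> A'))"

definition restrict_rel :: "('a \<times> 'a) set \<Rightarrow> 'a set \<Rightarrow> ('a \<times> 'a) set" where
  "restrict_rel s \<Delta> = s \<inter> \<Delta> \<times> \<Delta>"

definition winning_position ::
    "('a \<times> 'a) set set \<Rightarrow> (('a \<times> 'a) set \<Rightarrow> ('b \<times> 'b) set) \<Rightarrow> ('a, 'b) position \<Rightarrow> bool" where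
  "winning_position S \<phi> p \<longleftrightarrow>
     (let \<Delta> = fst ` ran p; \<Delta>' = snd ` ran p
      in \<exists>f. (\<forall>(a, b)\<in>ran p. f a = b) \<and> bij_betw f \<Delta> \<Delta>' \<and>
           (\<forall>s\<in>S. restrict_rel s \<Delta> \<noteq> {} \<longrightarrow>
              map_prod f f ` restrict_rel s \<Delta> = restrict_rel (\<phi> s) \<Delta>'))"

definition initial_position :: "'a list \<Rightarrow> 'b list \<Rightarrow> ('a, 'b) position" where
  "initial_position x x' = (\<lambda>i. if i < length x then Some (x ! i, x' ! i) else None)"

definition duplicator_wins ::
    "nat \<Rightarrow> 'a set \<Rightarrow> ('a \<times> 'a) set set \<Rightarrow> 'b set \<Rightarrow> (('a \<times> 'a) set \<Rightarrow> ('b \<times> 'b) set)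
      \<Rightarrow> 'a list \<Rightarrow> 'b list \<Rightarrow> bool" where
  "duplicator_wins k \<Omega> S \<Omega>' \<phi> x x' \<longleftrightarrow>
     (\<exists>D. \<forall>h\<in>plays k \<Omega> \<Omega>' D.
        legal_after k \<Omega> \<Omega>' D h \<and>
        winning_position S \<phi> (position_after (initial_position x x') h))"

definition T_rel ::
    "nat \<Rightarrow> 'a set \<Rightarrow> ('a \<times> 'a) set set \<Rightarrow> 'b set \<Rightarrow> (('a \<times> 'a) set \<Rightarrow> ('b \<times> 'b) set)
      \<Rightarrow> ('a list \<times> 'b list) set" where
  "T_rel m \<Omega> S \<Omega>' \<phi> =
     {(x, x') \<in> tuples \<Omega> m \<times> tuples \<Omega>' m. duplicator_wins (m + 1) \<Omega> S \<Omega>' \<phi> x x'}"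

end

theory Submission
  imports Defs
begin

text \<open>
  Call a relation \<open>E\<close> between the \<open>m\<close>-tuples of the two sides stable if related tuples have
  matching basis relations and equalities, and for related \<open>x\<close>, \<open>x'\<close> there is a bijection
  \<open>\<beta>\<close> with \<open>x[i := \<alpha>]\<close> related to \<open>x'[i := \<beta> \<alpha>]\<close> for all \<open>\<alpha>\<close> and \<open>i\<close>. The relation
  ``equal colour in every round, after renaming basis relations by \<open>\<phi>\<close>'' is the largest stable
  relation, and it coincides with the set of positions won by Duplicator: she maintains that the
  pairs under any \<open>m\<close> pebbles occur in a related pair of tuples, while Spoiler detects a difference
  in the multiplicity of a vector of colours. When it has full support, it induces a bijection of
  classes that is an algebraic isomorphism; conversely, \<open>x \<in> X\<close>, \<open>x' \<in> \<psi> X\<close> defines a stable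
  relation for every algebraic isomorphism \<open>\<psi>\<close> extending \<open>\<phi>\<close>. The closure of classes under
  non-injective reindexing rests on the largest stable relation being closed under passing to
  pairs of tuples whose entries occur in a related pair.
\<close>

section \<open>Stable relations between tuples\<close>

text \<open>For tuples of equal length this is equality of the initial colours after renaming by
  \<open>\<phi>\<close> (\<open>wl_sim_0\<close>), written out position by position.\<close>

definition compatible ::
    "('a \<times> 'a) set set \<Rightarrow> (('a \<times> 'a) set \<Rightarrow> ('b \<times> 'b) set) \<Rightarrow> 'a list \<Rightarrow> 'b list \<Rightarrow> bool" where
  "compatible S \<phi> x x' \<longleftrightarrow>
     (\<forall>i<length x. \<forall>j<length x. (x ! i = x ! j \<longleftrightarrow> x' ! i = x' ! j) \<and>
        (\<forall>s\<in>S. (x ! i, x ! j) \<in> s \<longleftrightarrow> (x' ! i, x' ! j) \<in> \<phi> s))"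

text \<open>One \<open>\<beta>\<close> serves all positions \<open>i\<close> at once, because a
  refinement round records for each point the whole vector of m colours.\<close>

definition stable_rel ::
    "nat \<Rightarrow> 'a set \<Rightarrow> ('a \<times> 'a) set set \<Rightarrow> 'b set \<Rightarrow> (('a \<times> 'a) set \<Rightarrow> ('b \<times> 'b) set)
      \<Rightarrow> ('a list \<times> 'b list) set \<Rightarrow> bool" where
  "stable_rel m \<Omega> S \<Omega>' \<phi> E \<longleftrightarrow>
     E \<subseteq> tuples \<Omega> m \<times> tuples \<Omega>' m \<and>
     (\<forall>(x, x')\<in>E. compatible S \<phi> x x' \<and>
        (\<exists>\<beta>. bij_betw \<beta> \<Omega> \<Omega>' \<and> (\<forall>\<alpha>\<in>\<Omega>. \<forall>i<m. (x[i := \<alpha>], x'[i := \<beta> \<alpha>]) \<in> E)))"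

lemma tuplesD: "x \<in> tuples \<Omega> m \<Longrightarrow> length x = m" "x \<in> tuples \<Omega> m \<Longrightarrow> i < m \<Longrightarrow> x ! i \<in> \<Omega>"
  by (auto simp: tuples_def)

lemma tuples_update: "x \<in> tuples \<Omega> m \<Longrightarrow> \<alpha> \<in> \<Omega> \<Longrightarrow> x[i := \<alpha>] \<in> tuples \<Omega> m"
  by (auto simp: tuples_def dest: subsetD[OF set_update_subset_insert])

lemma tuples_reindex:
  "x \<in> tuples \<Omega> m \<Longrightarrow> \<sigma> \<in> {..<m} \<rightarrow> {..<m} \<Longrightarrow> reindex \<sigma> x \<in> tuples \<Omega> m"
  by (fastforce simp: tuples_def reindex_def Pi_iff in_set_conv_nth)

lemma length_reindex [simp]: "length (reindex \<sigma> x) = length x"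
  by (simp add: reindex_def)

lemma nth_reindex [simp]: "i < length x \<Longrightarrow> reindex \<sigma> x ! i = x ! \<sigma> i"
  by (simp add: reindex_def)

lemma finite_tuples: "finite \<Omega> \<Longrightarrow> finite (tuples \<Omega> m)"
  unfolding tuples_def using finite_lists_length_eq[of \<Omega> m] by (simp add: conj_commute)

lemma partition_on_class: "partition_on A P \<Longrightarrow> x \<in> A \<Longrightarrow> \<exists>X\<in>P. x \<in> X"
  by (auto dest!: partition_onD1)

lemma partition_on_class_eq:
  "partition_on A P \<Longrightarrow> X \<in> P \<Longrightarrow> Y \<in> P \<Longrightarrow> x \<in> X \<Longrightarrow> x \<in> Y \<Longrightarrow> X = Y"
  using disjointD partition_onD2 by blast

lemma compatible_rel:
  "compatible S \<phi> x x' \<Longrightarrow> i < length x \<Longrightarrow> j < length x \<Longrightarrow> s \<in> S \<Longrightarrow>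
    (x ! i, x ! j) \<in> s \<longleftrightarrow> (x' ! i, x' ! j) \<in> \<phi> s"
  by (simp add: compatible_def)

lemma compatibleD:
  assumes "compatible S \<phi> y y'" "length y' = length y"
    and "(a, b) \<in> set (zip y y')" "(c, d) \<in> set (zip y y')"
  shows "a = c \<longleftrightarrow> b = d" "s \<in> S \<Longrightarrow> (a, c) \<in> s \<longleftrightarrow> (b, d) \<in> \<phi> s"
  using assms unfolding compatible_def by (auto simp: set_zip)

lemma compatible_if_covered:
  assumes "compatible S \<phi> y y'" "length y' = length y"
    and "length x' = length x" "set (zip x x') \<subseteq> set (zip y y')"
  shows "compatible S \<phi> x x'"
  unfolding compatible_def
proof (intro allI impI)
  fix i j assume "i < length x" "j < length x"
  then have "(x ! i, x' ! i) \<in> set (zip y y')" "(x ! j, x' ! j) \<in> set (zip y y')"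
    using assms(3,4) by (auto simp: set_zip)
  from compatibleD[OF assms(1,2) this]
  show "(x ! i = x ! j \<longleftrightarrow> x' ! i = x' ! j) \<and> (\<forall>s\<in>S. (x ! i, x ! j) \<in> s \<longleftrightarrow> (x' ! i, x' ! j) \<in> \<phi> s)"
    by blast
qed

text \<open>Pigeonhole: one position per pair of \<open>P\<close> uses fewer than m positions, so
  some \<open>k\<close> is free to be overwritten. It is fixed before \<open>a\<close> and
  \<open>b\<close>, so a single \<open>k\<close> serves all new pairs.\<close>

lemma zip_update_covers:
  assumes "length y = m" "length y' = m" "P \<subseteq> set (zip y y')" "card P < m"
  obtains k where "k < m" "\<And>a b. insert (a, b) P \<subseteq> set (zip (y[k := a]) (y'[k := b]))"
proof -
  have fin: "finite P" using assms(3) finite_subset by blast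
  have "\<forall>p\<in>P. \<exists>i<m. p = (y ! i, y' ! i)" using assms by (auto simp: set_zip)
  then obtain g where g: "\<And>p. p \<in> P \<Longrightarrow> g p < m \<and> p = (y ! g p, y' ! g p)" by metis
  have "card (g ` P) < card {..<m}" using card_image_le[OF fin, of g] assms(4) by simp
  moreover have "g ` P \<subseteq> {..<m}" using g by auto
  ultimately obtain k where k: "k < m" "k \<notin> g ` P"
    by (metis lessThan_iff less_irrefl subsetI subset_antisym)
  show thesis
  proof (rule that[OF k(1)])
    fix a b
    have "p \<in> set (zip (y[k := a]) (y'[k := b]))" if "p \<in> P" for p
    proof -
      have "g p \<noteq> k" using k that by auto
      then show ?thesis using g[OF that] assms(1,2)
        by (auto simp: set_zip intro!: exI[of _ "g p"])
    qed
    moreover have "(a, b) \<in> set (zip (y[k := a]) (y'[k := b]))"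
      using k(1) assms(1,2) by (auto simp: set_zip intro!: exI[of _ k])
    ultimately show "insert (a, b) P \<subseteq> set (zip (y[k := a]) (y'[k := b]))" by blast
  qed
qed

lemma stable_relD:
  assumes "stable_rel m \<Omega> S \<Omega>' \<phi> E" "(x, x') \<in> E"
  shows "x \<in> tuples \<Omega> m" "x' \<in> tuples \<Omega>' m" "length x = m" "length x' = m" "compatible S \<phi> x x'"
  using assms unfolding stable_rel_def by (auto dest: tuplesD)

lemma stable_rel_bij:
  assumes "stable_rel m \<Omega> S \<Omega>' \<phi> E" "(x, x') \<in> E"
  obtains \<beta> where "bij_betw \<beta> \<Omega> \<Omega>'"
    "\<And>\<alpha> i. \<alpha> \<in> \<Omega> \<Longrightarrow> i < m \<Longrightarrow> (x[i := \<alpha>], x'[i := \<beta> \<alpha>]) \<in> E"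
  using assms unfolding stable_rel_def by blast

section \<open>Closure of stable relations under covered pairs\<close>

definition covered_pairs ::
    "nat \<Rightarrow> 'a set \<Rightarrow> 'b set \<Rightarrow> ('a list \<times> 'b list) set \<Rightarrow> ('a list \<times> 'b list) set" where
  "covered_pairs m \<Omega> \<Omega>' E = {(x, x') \<in> tuples \<Omega> m \<times> tuples \<Omega>' m.
     \<exists>(y, y')\<in>E. set (zip x x') \<subseteq> set (zip y y')}"

text \<open>The bijection of the covering pair \<open>(y, y')\<close> is reused for
  \<open>(x, x')\<close>: overwriting entry \<open>i\<close> keeps at most m - 1 old pairs, so by
  \<open>zip_update_covers\<close> some entry of \<open>y\<close> can take the new pair while these
  stay covered.\<close>

lemma stable_rel_covered_pairs:
  assumes E: "stable_rel m \<Omega> S \<Omega>' \<phi> E"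
  shows "stable_rel m \<Omega> S \<Omega>' \<phi> (covered_pairs m \<Omega> \<Omega>' E)"
  unfolding stable_rel_def
proof (intro conjI ballI)
  show "covered_pairs m \<Omega> \<Omega>' E \<subseteq> tuples \<Omega> m \<times> tuples \<Omega>' m" by (auto simp: covered_pairs_def)
  fix z assume "z \<in> covered_pairs m \<Omega> \<Omega>' E"
  then obtain x x' y y' where z: "z = (x, x')" and x: "x \<in> tuples \<Omega> m" "x' \<in> tuples \<Omega>' m"
    and y: "(y, y') \<in> E" "set (zip x x') \<subseteq> set (zip y y')"
    by (auto simp: covered_pairs_def)
  note yD = stable_relD[OF E y(1)] and lx = tuplesD(1)[OF x(1)] tuplesD(1)[OF x(2)]
  have comp: "compatible S \<phi> x x'"
    using compatible_if_covered[OF yD(5) _ _ y(2)] yD lx by simp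
  obtain \<beta> where \<beta>: "bij_betw \<beta> \<Omega> \<Omega>'"
    "\<And>\<alpha> i. \<alpha> \<in> \<Omega> \<Longrightarrow> i < m \<Longrightarrow> (y[i := \<alpha>], y'[i := \<beta> \<alpha>]) \<in> E"
    using stable_rel_bij[OF E y(1)] by metis
  have "(x[i := \<alpha>], x'[i := \<beta> \<alpha>]) \<in> covered_pairs m \<Omega> \<Omega>' E" if \<alpha>: "\<alpha> \<in> \<Omega>" and i: "i < m" for \<alpha> i
  proof -
    define P where "P = (\<lambda>k. (x ! k, x' ! k)) ` ({..<m} - {i})"
    have "card P \<le> card ({..<m} - {i})" unfolding P_def by (rule card_image_le) simp
    also have "\<dots> < m" using i by simp
    finally have cP: "card P < m" .
    have "P \<subseteq> set (zip y y')" using y(2) lx by (auto simp: P_def set_zip)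
    then obtain k where k: "k < m" "\<And>a b. insert (a, b) P \<subseteq> set (zip (y[k := a]) (y'[k := b]))"
      using zip_update_covers[OF yD(3,4) _ cP] by metis
    have "set (zip (x[i := \<alpha>]) (x'[i := \<beta> \<alpha>])) \<subseteq> insert (\<alpha>, \<beta> \<alpha>) P"
    proof
      fix p assume "p \<in> set (zip (x[i := \<alpha>]) (x'[i := \<beta> \<alpha>]))"
      then obtain k where k: "k < m" "p = (x[i := \<alpha>] ! k, x'[i := \<beta> \<alpha>] ! k)"
        using lx by (auto simp: set_zip)
      then show "p \<in> insert (\<alpha>, \<beta> \<alpha>) P" using lx i by (cases "k = i") (auto simp: P_def)
    qed
    then have "set (zip (x[i := \<alpha>]) (x'[i := \<beta> \<alpha>])) \<subseteq> set (zip (y[k := \<alpha>]) (y'[k := \<beta> \<alpha>]))"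
      using k(2) by blast
    moreover have "\<beta> \<alpha> \<in> \<Omega>'" using \<beta>(1) \<alpha> by (auto simp: bij_betw_def)
    ultimately show ?thesis using \<beta>(2)[OF \<alpha> k(1)] tuples_update[OF x(1) \<alpha>] tuples_update[OF x(2)]
      unfolding covered_pairs_def by blast
  qed
  with comp \<beta>(1) show "case z of (x, x') \<Rightarrow> compatible S \<phi> x x' \<and> (\<exists>\<beta>. bij_betw \<beta> \<Omega> \<Omega>' \<and>
      (\<forall>\<alpha>\<in>\<Omega>. \<forall>i<m. (x[i := \<alpha>], x'[i := \<beta> \<alpha>]) \<in> covered_pairs m \<Omega> \<Omega>' E))"
    by (auto simp: z)
qed


section \<open>Colours and stable relations\<close>

lemma count_image_mset_set:
  "finite A \<Longrightarrow> count (image_mset f (mset_set A)) c = card {a \<in> A. f a = c}"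
  by (simp add: count_image_mset' eq_commute[of c])

text \<open>Equal multisets have fibres of equal size over every value, and bijections between the
  fibres glue to \<open>\<beta>\<close>. This turns the multisets of the refinement into the
  bijections of stable relations.\<close>

lemma image_mset_set_eq_iff:
  assumes "finite A" "finite B"
  shows "image_mset f (mset_set A) = image_mset g (mset_set B) \<longleftrightarrow>
    (\<exists>\<beta>. bij_betw \<beta> A B \<and> (\<forall>a\<in>A. f a = g (\<beta> a)))"
proof
  assume "image_mset f (mset_set A) = image_mset g (mset_set B)"
  then have "card {a \<in> A. f a = c} = card {b \<in> B. g b = c}" for c
    using count_image_mset_set[OF assms(1)] count_image_mset_set[OF assms(2)] by metis
  then have "\<exists>h. bij_betw h {a \<in> A. f a = c} {b \<in> B. g b = c}" for c
    using assms by (intro finite_same_card_bij) auto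
  then obtain h where h: "\<And>c. bij_betw (h c) {a \<in> A. f a = c} {b \<in> B. g b = c}" by metis
  define \<beta> where "\<beta> a = h (f a) a" for a
  have \<beta>: "\<beta> a \<in> B \<and> g (\<beta> a) = f a" if "a \<in> A" for a
    using bij_betw_apply[OF h[of "f a"], of a] that by (simp add: \<beta>_def)
  have "inj_on \<beta> A"
  proof (rule inj_onI)
    fix a a' assume a: "a \<in> A" "a' \<in> A" "\<beta> a = \<beta> a'"
    then have "f a = f a'" using \<beta> by metis
    then show "a = a'" using a inj_onD[OF bij_betw_imp_inj_on[OF h[of "f a"]], of a a']
      by (simp add: \<beta>_def)
  qed
  moreover have "b \<in> \<beta> ` A" if "b \<in> B" for b
    using that bij_betw_imp_surj_on[OF h[of "g b"]] by (force simp: \<beta>_def image_iff)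
  ultimately have "bij_betw \<beta> A B" using \<beta> by (auto simp: bij_betw_def)
  with \<beta> show "\<exists>\<beta>. bij_betw \<beta> A B \<and> (\<forall>a\<in>A. f a = g (\<beta> a))" by metis
next
  assume "\<exists>\<beta>. bij_betw \<beta> A B \<and> (\<forall>a\<in>A. f a = g (\<beta> a))"
  then obtain \<beta> where \<beta>: "bij_betw \<beta> A B" "\<And>a. a \<in> A \<Longrightarrow> f a = g (\<beta> a)" by blast
  have "mset_set B = image_mset \<beta> (mset_set A)"
    using \<beta>(1) by (simp add: bij_betw_def image_mset_mset_set)
  then show "image_mset f (mset_set A) = image_mset g (mset_set B)"
    using \<beta>(2) assms(1) by (auto simp: multiset.map_comp intro!: image_mset_cong)
qed

text \<open>The colours of the two sides have different types. Mapping this function over a colour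
  renames the basis relations inside it by \<open>\<phi>\<close> and keeps the equality patterns,
  which makes the two sides comparable.\<close>

definition translate_atom ::
    "(('a \<times> 'a) set \<Rightarrow> ('b \<times> 'b) set) \<Rightarrow> (nat \<times> nat) set \<times> (nat \<times> nat \<times> ('a \<times> 'a) set) set
      \<Rightarrow> (nat \<times> nat) set \<times> (nat \<times> nat \<times> ('b \<times> 'b) set) set" where
  "translate_atom \<phi> = map_prod id (image (map_prod id (map_prod id \<phi>)))"

lemma translate_atom_id: "translate_atom id = id"
  by (simp add: translate_atom_def prod.map_id0)

text \<open>Two sides are treated at once; the instance with equal sides and
  \<open>\<phi> = id\<close> in \<open>wl_single\<close> describes the Weisfeiler-Leman classes of
  one side.\<close>

locale wl_pair =
  fixes \<Omega> :: "'a set" and S :: "('a \<times> 'a) set set"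
    and \<Omega>' :: "'b set" and S' :: "('b \<times> 'b) set set"
    and m :: nat and \<phi> :: "('a \<times> 'a) set \<Rightarrow> ('b \<times> 'b) set"
  assumes fin: "finite \<Omega>" "finite \<Omega>'" and bij: "bij_betw \<phi> S S'"
begin

definition wl_sim :: "nat \<Rightarrow> 'a list \<Rightarrow> 'b list \<Rightarrow> bool" where
  "wl_sim n x x' \<longleftrightarrow>
     map_colour (translate_atom \<phi>) (wl_colour \<Omega> S n x) = wl_colour \<Omega>' S' n x'"

definition wl_rel :: "('a list \<times> 'b list) set" where
  "wl_rel = {(x, x') \<in> tuples \<Omega> m \<times> tuples \<Omega>' m. \<forall>n. wl_sim n x x'}"

lemma wl_sim_0:
  assumes "length x' = length x"
  shows "wl_sim 0 x x' \<longleftrightarrow> compatible S \<phi> x x'"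
proof -
  let ?R = "{(i, j, s). i < length x \<and> j < length x \<and> s \<in> S \<and> (x ! i, x ! j) \<in> s}"
  let ?R' = "{(i, j, s). i < length x \<and> j < length x \<and> s \<in> S' \<and> (x' ! i, x' ! j) \<in> s}"
  have im: "map_prod id (map_prod id \<phi>) ` ?R
      = {(i, j, \<phi> s) | i j s. i < length x \<and> j < length x \<and> s \<in> S \<and> (x ! i, x ! j) \<in> s}"
    by (force simp: image_iff)
  have inj: "\<And>s t. s \<in> S \<Longrightarrow> t \<in> S \<Longrightarrow> \<phi> s = \<phi> t \<Longrightarrow> s = t"
    using bij by (auto simp: bij_betw_def inj_on_def)
  have S': "S' = \<phi> ` S" using bij by (auto simp: bij_betw_def)
  have rels: "map_prod id (map_prod id \<phi>) ` ?R = ?R' \<longleftrightarrow>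
    (\<forall>i<length x. \<forall>j<length x. \<forall>s\<in>S. (x ! i, x ! j) \<in> s \<longleftrightarrow> (x' ! i, x' ! j) \<in> \<phi> s)"
    (is "?L \<longleftrightarrow> ?M")
  proof
    assume L: ?L
    show ?M
    proof (intro allI impI ballI)
      fix i j s assume ij: "i < length x" "j < length x" "s \<in> S"
      have "(x' ! i, x' ! j) \<in> \<phi> s \<longleftrightarrow> (i, j, \<phi> s) \<in> ?R'" using ij S' by simp
      also have "\<dots> \<longleftrightarrow> (i, j, \<phi> s) \<in> map_prod id (map_prod id \<phi>) ` ?R" using L by simp
      \<comment> \<open>Injectivity of \<open>\<phi>\<close> on \<open>S\<close> lets
        \<open>s\<close> be recovered from \<open>\<phi> s\<close>.\<close>
      also have "\<dots> \<longleftrightarrow> (x ! i, x ! j) \<in> s" unfolding im using ij inj by auto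
      finally show "(x ! i, x ! j) \<in> s \<longleftrightarrow> (x' ! i, x' ! j) \<in> \<phi> s" by simp
    qed
  next
    assume M: ?M
    have "?R' = {(i, j, \<phi> s) | i j s. i < length x \<and> j < length x \<and> s \<in> S \<and> (x' ! i, x' ! j) \<in> \<phi> s}"
      unfolding S' by auto
    also have "\<dots> = {(i, j, \<phi> s) | i j s. i < length x \<and> j < length x \<and> s \<in> S \<and> (x ! i, x ! j) \<in> s}"
      using M by (intro Collect_cong) blast
    finally show ?L unfolding im by simp
  qed
  have pat: "eq_pattern x = eq_pattern x' \<longleftrightarrow>
      (\<forall>i<length x. \<forall>j<length x. x ! i = x ! j \<longleftrightarrow> x' ! i = x' ! j)"
    using assms by (auto simp: eq_pattern_def set_eq_iff)
  have sim: "wl_sim 0 x x' \<longleftrightarrow>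
      eq_pattern x = eq_pattern x' \<and> map_prod id (map_prod id \<phi>) ` ?R = ?R'"
    by (simp add: wl_sim_def translate_atom_def assms)
  have "(\<forall>i<n. \<forall>j<n. P i j) \<and> (\<forall>i<n. \<forall>j<n. Q i j) \<longleftrightarrow> (\<forall>i<n. \<forall>j<n. P i j \<and> Q i j)"
    for P Q and n :: nat by blast
  then show ?thesis unfolding sim rels pat compatible_def .
qed

lemma wl_sim_Suc:
  assumes "length x' = length x"
  shows "wl_sim (Suc n) x x' \<longleftrightarrow> wl_sim n x x' \<and>
    (\<exists>\<beta>. bij_betw \<beta> \<Omega> \<Omega>' \<and> (\<forall>\<alpha>\<in>\<Omega>. \<forall>i<length x. wl_sim n (x[i := \<alpha>]) (x'[i := \<beta> \<alpha>])))"
proof -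
  have "image_mset (map (map_colour (translate_atom \<phi>)))
        {# map (\<lambda>i. wl_colour \<Omega> S n (x[i := \<alpha>])) [0..<length x]. \<alpha> \<in># mset_set \<Omega> #}
      = {# map (\<lambda>i. map_colour (translate_atom \<phi>) (wl_colour \<Omega> S n (x[i := \<alpha>]))) [0..<length x].
          \<alpha> \<in># mset_set \<Omega> #}"
    by (simp add: multiset.map_comp comp_def)
  then show ?thesis
    using assms by (simp add: wl_sim_def image_mset_set_eq_iff[OF fin] Ball_def)
qed

lemma stable_rel_imp_wl_sim:
  assumes E: "stable_rel m \<Omega> S \<Omega>' \<phi> E" and "(x, x') \<in> E"
  shows "wl_sim n x x'"
  using assms(2)
proof (induction n arbitrary: x x')
  case 0
  then show ?case using wl_sim_0 stable_relD[OF E] by metis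
next
  case (Suc n)
  obtain \<beta> where "bij_betw \<beta> \<Omega> \<Omega>'"
    "\<And>\<alpha> i. \<alpha> \<in> \<Omega> \<Longrightarrow> i < m \<Longrightarrow> (x[i := \<alpha>], x'[i := \<beta> \<alpha>]) \<in> E"
    using stable_rel_bij[OF E Suc.prems] by metis
  then show ?case using Suc stable_relD(3,4)[OF E Suc.prems] by (auto simp: wl_sim_Suc)
qed

lemma stable_rel_subset_wl_rel:
  "stable_rel m \<Omega> S \<Omega>' \<phi> E \<Longrightarrow> E \<subseteq> wl_rel"
  using stable_rel_imp_wl_sim stable_relD by (fastforce simp: wl_rel_def)

section \<open>Stabilisation of the refinement rounds\<close>

definition wl_level :: "nat \<Rightarrow> ('a list \<times> 'b list) set" where
  "wl_level n = {(x, x') \<in> tuples \<Omega> m \<times> tuples \<Omega>' m. wl_sim n x x'}"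

lemma wl_level_antimono: "n \<le> k \<Longrightarrow> wl_level k \<subseteq> wl_level n"
proof (induction k rule: dec_induct)
  case (step k)
  have "wl_level (Suc k) \<subseteq> wl_level k"
    using wl_sim_Suc[of _ _ k] by (auto simp: wl_level_def tuples_def)
  with step show ?case by blast
qed simp

text \<open>A level depends only on the one before: a bijection leading into level \<open>n\<close>
  leads, by assumption, into level \<open>Suc n\<close> as well.\<close>

lemma wl_level_Suc_cong:
  assumes "wl_level (Suc n) = wl_level n"
  shows "wl_level (Suc (Suc n)) = wl_level (Suc n)"
proof
  show "wl_level (Suc (Suc n)) \<subseteq> wl_level (Suc n)" by (rule wl_level_antimono) simp
  show "wl_level (Suc n) \<subseteq> wl_level (Suc (Suc n))"
  proof
    fix z assume z: "z \<in> wl_level (Suc n)"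
    then obtain x x' where x: "z = (x, x')" "x \<in> tuples \<Omega> m" "x' \<in> tuples \<Omega>' m" "wl_sim (Suc n) x x'"
      by (auto simp: wl_level_def)
    note l = tuplesD(1)[OF x(2)] tuplesD(1)[OF x(3)]
    obtain \<beta> where \<beta>: "bij_betw \<beta> \<Omega> \<Omega>'"
      "\<And>\<alpha> i. \<alpha> \<in> \<Omega> \<Longrightarrow> i < m \<Longrightarrow> wl_sim n (x[i := \<alpha>]) (x'[i := \<beta> \<alpha>])"
      using x(4) l by (auto simp: wl_sim_Suc[of x'])
    have "wl_sim (Suc n) (x[i := \<alpha>]) (x'[i := \<beta> \<alpha>])" if "\<alpha> \<in> \<Omega>" "i < m" for \<alpha> i
    proof -
      have "(x[i := \<alpha>], x'[i := \<beta> \<alpha>]) \<in> wl_level n"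
        using \<beta> that x(2,3) by (auto simp: wl_level_def intro!: tuples_update bij_betw_apply[OF \<beta>(1)])
      then show ?thesis using assms by (auto simp: wl_level_def)
    qed
    then have "wl_sim (Suc (Suc n)) x x'"
      using wl_sim_Suc[of x' x "Suc n"] l x(4) \<beta>(1) by auto
    then show "z \<in> wl_level (Suc (Suc n))" using x by (auto simp: wl_level_def)
  qed
qed

lemma wl_level_stable:
  assumes "wl_level (Suc n) = wl_level n"
  shows "wl_rel = wl_level n"
proof -
  have *: "wl_level (Suc (n + k)) = wl_level (n + k)" for k
    by (induction k) (use assms wl_level_Suc_cong in auto)
  have "wl_level (n + k) = wl_level n" for k
    by (induction k) (use * in auto)
  moreover have "wl_level (n + k) \<subseteq> wl_level k" for k by (rule wl_level_antimono) simp
  ultimately have "wl_level n \<subseteq> wl_level k" for k by blast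
  then show ?thesis by (fastforce simp: wl_level_def wl_rel_def)
qed

text \<open>The levels decrease inside a finite set; if every inclusion were strict, the cardinality
  would drop forever.\<close>

lemma wl_level_eventually: "\<exists>n. wl_level (Suc n) = wl_level n"
proof (rule ccontr)
  assume "\<nexists>n. wl_level (Suc n) = wl_level n"
  then have less: "wl_level (Suc n) \<subset> wl_level n" for n
    using wl_level_antimono[of n "Suc n"] by auto
  have finl: "finite (wl_level n)" for n
    by (rule finite_subset[of _ "tuples \<Omega> m \<times> tuples \<Omega>' m"])
      (auto simp: wl_level_def finite_tuples fin)
  have "card (wl_level n) + n \<le> card (wl_level 0)" for n
  proof (induction n)
    case (Suc n)
    then show ?case using psubset_card_mono[OF finl less, of n] by linarith
  qed simp
  from this[of "Suc (card (wl_level 0))"] show False by simp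
qed

text \<open>Each round supplies its own bijection. The one from round \<open>Suc n\<close>, for a
  level \<open>n\<close> that no longer changes, works for all rounds together.\<close>

lemma stable_rel_wl_rel: "stable_rel m \<Omega> S \<Omega>' \<phi> wl_rel"
proof -
  obtain n where n: "wl_level (Suc n) = wl_level n" using wl_level_eventually by blast
  note eq = wl_level_stable[OF n]
  show ?thesis unfolding stable_rel_def
  proof (intro conjI ballI)
    show "wl_rel \<subseteq> tuples \<Omega> m \<times> tuples \<Omega>' m" by (auto simp: wl_rel_def)
    fix z assume z: "z \<in> wl_rel"
    then obtain x x' where x: "z = (x, x')" "x \<in> tuples \<Omega> m" "x' \<in> tuples \<Omega>' m" "\<And>n. wl_sim n x x'"
      by (auto simp: wl_rel_def)
    note l = tuplesD(1)[OF x(2)] tuplesD(1)[OF x(3)]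
    obtain \<beta> where \<beta>: "bij_betw \<beta> \<Omega> \<Omega>'"
      "\<And>\<alpha> i. \<alpha> \<in> \<Omega> \<Longrightarrow> i < m \<Longrightarrow> wl_sim n (x[i := \<alpha>]) (x'[i := \<beta> \<alpha>])"
      using x(4)[of "Suc n"] l by (auto simp: wl_sim_Suc[of x'])
    have "(x[i := \<alpha>], x'[i := \<beta> \<alpha>]) \<in> wl_rel" if "\<alpha> \<in> \<Omega>" "i < m" for \<alpha> i
      unfolding eq using \<beta> that x(2,3)
      by (auto simp: wl_level_def intro!: tuples_update bij_betw_apply[OF \<beta>(1)])
    moreover have "compatible S \<phi> x x'" using x(4)[of 0] wl_sim_0 l by metis
    ultimately show "case z of (x, x') \<Rightarrow> compatible S \<phi> x x' \<and> (\<exists>\<beta>. bij_betw \<beta> \<Omega> \<Omega>' \<and>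
        (\<forall>\<alpha>\<in>\<Omega>. \<forall>i<m. (x[i := \<alpha>], x'[i := \<beta> \<alpha>]) \<in> wl_rel))"
      using \<beta>(1) x(1) by auto
  qed
qed

section \<open>Reindexing related tuples\<close>

lemmas wl_relD = stable_relD[OF stable_rel_wl_rel]

text \<open>The covered pairs of \<open>wl_rel\<close> form a stable relation, and
  \<open>wl_rel\<close> contains every stable relation.\<close>

lemma wl_rel_covered:
  assumes "(y, y') \<in> wl_rel" "x \<in> tuples \<Omega> m" "x' \<in> tuples \<Omega>' m" "set (zip x x') \<subseteq> set (zip y y')"
  shows "(x, x') \<in> wl_rel"
  using stable_rel_subset_wl_rel[OF stable_rel_covered_pairs[OF stable_rel_wl_rel]] assms
  by (auto simp: covered_pairs_def)

lemma wl_rel_reindex: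
  assumes "(x, x') \<in> wl_rel" "\<sigma> \<in> {..<m} \<rightarrow> {..<m}"
  shows "(reindex \<sigma> x, reindex \<sigma> x') \<in> wl_rel"
proof (rule wl_rel_covered[OF assms(1)])
  note D = wl_relD[OF assms(1)]
  show "reindex \<sigma> x \<in> tuples \<Omega> m" "reindex \<sigma> x' \<in> tuples \<Omega>' m"
    using D assms(2) by (auto intro: tuples_reindex)
  show "set (zip (reindex \<sigma> x) (reindex \<sigma> x')) \<subseteq> set (zip x x')"
    using D(3,4) assms(2) by (fastforce simp: set_zip)
qed

text \<open>This makes reindexing map a class onto a whole class. Reindexing by a section
  \<open>\<tau>\<close> of \<open>\<sigma>\<close> restores the entries of \<open>x\<close> at the
  positions in the image of \<open>\<sigma>\<close>; the other entries of \<open>x\<close> are then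
  inserted one at a time, each answered by a bijection from stability.\<close>

lemma wl_rel_lift_reindex:
  assumes rel: "(reindex \<sigma> x, z) \<in> wl_rel" and x: "x \<in> tuples \<Omega> m" and \<sigma>: "\<sigma> \<in> {..<m} \<rightarrow> {..<m}"
  obtains y where "(x, y) \<in> wl_rel" "reindex \<sigma> y = z"
proof -
  note D = wl_relD[OF rel] and lx = tuplesD(1)[OF x]
  \<comment> \<open>Off the image of \<open>\<sigma>\<close> the default \<open>k\<close> only keeps
    \<open>\<tau>\<close> within range; those positions are overwritten below.\<close>
  define \<tau> where "\<tau> k = (if k \<in> \<sigma> ` {..<m} then inv_into {..<m} \<sigma> k else k)" for k
  have \<tau>: "\<tau> \<in> {..<m} \<rightarrow> {..<m}" unfolding \<tau>_def
    using inv_into_into[of _ \<sigma> "{..<m}"] by auto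
  have \<sigma>\<tau>: "\<sigma> (\<tau> k) = k" if "k \<in> \<sigma> ` {..<m}" for k
    unfolding \<tau>_def using that f_inv_into_f[of k \<sigma> "{..<m}"] by simp
  have base: "(reindex \<tau> (reindex \<sigma> x), reindex \<tau> z) \<in> wl_rel" by (rule wl_rel_reindex[OF rel \<tau>])
  have "j \<le> m \<Longrightarrow> \<exists>w y. (w, y) \<in> wl_rel \<and> (\<forall>k \<in> \<sigma> ` {..<m} \<union> {..<j}. w ! k = x ! k) \<and>
      (\<forall>k \<in> \<sigma> ` {..<m}. y ! k = z ! \<tau> k)" for j
  proof (induction j)
    case 0
    have "reindex \<tau> (reindex \<sigma> x) ! k = x ! k" "reindex \<tau> z ! k = z ! \<tau> k"
      if "k \<in> \<sigma> ` {..<m}" for k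
    proof -
      have "k < m" "\<tau> k < m" using that \<sigma> \<tau> by auto
      then show "reindex \<tau> (reindex \<sigma> x) ! k = x ! k" "reindex \<tau> z ! k = z ! \<tau> k"
        using lx D(4) \<sigma>\<tau>[OF that] by simp_all
    qed
    with base show ?case by (metis Un_empty_right lessThan_0)
  next
    case (Suc j)
    then obtain w y where wy: "(w, y) \<in> wl_rel" "\<forall>k \<in> \<sigma> ` {..<m} \<union> {..<j}. w ! k = x ! k"
      "\<forall>k \<in> \<sigma> ` {..<m}. y ! k = z ! \<tau> k" by auto
    show ?case
    proof (cases "j \<in> \<sigma> ` {..<m}")
      case True
      then have "\<sigma> ` {..<m} \<union> {..<Suc j} = \<sigma> ` {..<m} \<union> {..<j}" by (auto simp: less_Suc_eq)
      with wy show ?thesis by metis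
    next
      case False
      obtain \<beta> where "bij_betw \<beta> \<Omega> \<Omega>'"
        and \<beta>: "\<And>\<alpha> i. \<alpha> \<in> \<Omega> \<Longrightarrow> i < m \<Longrightarrow> (w[i := \<alpha>], y[i := \<beta> \<alpha>]) \<in> wl_rel"
        using stable_rel_bij[OF stable_rel_wl_rel wy(1)] by metis
      have "(w[j := x ! j], y[j := \<beta> (x ! j)]) \<in> wl_rel"
        using \<beta> tuplesD(2)[OF x] Suc.prems by auto
      moreover have "\<forall>k \<in> \<sigma> ` {..<m} \<union> {..<Suc j}. w[j := x ! j] ! k = x ! k"
        using wy(2) Suc.prems wl_relD(3)[OF wy(1)] by (auto simp: nth_list_update less_Suc_eq)
      moreover have "\<forall>k \<in> \<sigma> ` {..<m}. y[j := \<beta> (x ! j)] ! k = z ! \<tau> k"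
        using wy(3) False by (metis nth_list_update_neq)
      ultimately show ?thesis by blast
    qed
  qed
  from this[of m] obtain w y where wy: "(w, y) \<in> wl_rel" "\<forall>k \<in> \<sigma> ` {..<m} \<union> {..<m}. w ! k = x ! k"
      "\<forall>k \<in> \<sigma> ` {..<m}. y ! k = z ! \<tau> k" by auto
  have "w = x" using wy(2) wl_relD(3)[OF wy(1)] lx by (auto intro: nth_equalityI)
  moreover have "reindex \<sigma> y = z"
  proof (rule nth_equalityI)
    fix i assume "i < length (reindex \<sigma> y)"
    then have i: "i < m" using wl_relD(4)[OF wy(1)] by simp
    then have \<sigma>i: "\<sigma> i \<in> \<sigma> ` {..<m}" "\<sigma> i < m" "\<tau> (\<sigma> i) < m" using \<sigma> \<tau> by auto
    \<comment> \<open>For non-injective \<open>\<sigma>\<close> the position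
      \<open>\<tau> (\<sigma> i)\<close> may differ from \<open>i\<close>, but
      \<open>reindex \<sigma> x\<close> has equal entries at both, and compatibility carries this
      equality over to \<open>z\<close>.\<close>
    have "reindex \<sigma> x ! \<tau> (\<sigma> i) = reindex \<sigma> x ! i" using \<sigma>i i lx \<sigma>\<tau> by simp
    then have "z ! \<tau> (\<sigma> i) = z ! i" using D(3,5) i \<sigma>i by (auto simp: compatible_def)
    then show "reindex \<sigma> y ! i = z ! i" using wy(3) \<sigma>i(1) i wl_relD(4)[OF wy(1)] by simp
  qed (use wl_relD(4)[OF wy(1)] D(4) in simp)
  ultimately show thesis using that wy(1) by blast
qed

end


section \<open>The Weisfeiler--Leman partition\<close>

locale wl_single =
  fixes \<Omega> :: "'a set" and S :: "('a \<times> 'a) set set" and m :: nat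
  assumes fin_single: "finite \<Omega>"
begin

sublocale wl_pair \<Omega> S \<Omega> S m id
  by unfold_locales (use fin_single in auto)

lemma wl_sim_iff: "wl_sim n x y \<longleftrightarrow> wl_colour \<Omega> S n x = wl_colour \<Omega> S n y"
  by (simp add: wl_sim_def translate_atom_id colour.map_id)

lemma equiv_wl_rel: "equiv (tuples \<Omega> m) wl_rel"
  by (rule equivI) (auto simp: refl_on_def sym_def trans_def wl_rel_def wl_sim_iff)

lemma wl_rel_eq_stable_round:
  "wl_rel = {(x, y) \<in> tuples \<Omega> m \<times> tuples \<Omega> m.
     wl_colour \<Omega> S (stable_round m \<Omega> S) x = wl_colour \<Omega> S (stable_round m \<Omega> S) y}"
proof -
  \<comment> \<open>The condition under \<open>LEAST\<close> compares two colour partitions pair by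
    pair, which is equality of consecutive levels for \<open>\<phi> = id\<close>.\<close>
  have "stable_round m \<Omega> S = (LEAST n. wl_level (Suc n) = wl_level n)"
    unfolding stable_round_def
    by (rule arg_cong[of _ _ Least]) (auto simp: wl_level_def wl_sim_iff fun_eq_iff set_eq_iff)
  then have "wl_level (Suc (stable_round m \<Omega> S)) = wl_level (stable_round m \<Omega> S)"
    using LeastI_ex[OF wl_level_eventually] by simp
  from wl_level_stable[OF this] show ?thesis by (simp only: wl_level_def wl_sim_iff)
qed

lemma WL_eq_quotient: "WL m \<Omega> S = tuples \<Omega> m // wl_rel"
proof -
  have "{y \<in> tuples \<Omega> m. wl_colour \<Omega> S (stable_round m \<Omega> S) y = wl_colour \<Omega> S (stable_round m \<Omega> S) x}
      = wl_rel `` {x}" if "x \<in> tuples \<Omega> m" for x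
    using that by (auto simp: wl_rel_eq_stable_round)
  then show ?thesis unfolding WL_def Let_def quotient_def by auto
qed

lemma WL_class_mem: "x \<in> tuples \<Omega> m \<Longrightarrow> wl_rel `` {x} \<in> WL m \<Omega> S"
  by (simp add: WL_eq_quotient quotientI)

lemma self_in_class: "x \<in> tuples \<Omega> m \<Longrightarrow> x \<in> wl_rel `` {x}"
  using equiv_class_self[OF equiv_wl_rel] .

lemma WL_class_eq: "X \<in> WL m \<Omega> S \<Longrightarrow> x \<in> X \<Longrightarrow> X = wl_rel `` {x}"
  unfolding WL_eq_quotient by (auto elim!: quotientE dest: equiv_class_eq[OF equiv_wl_rel])

lemma WL_classE:
  assumes "X \<in> WL m \<Omega> S"
  obtains x where "x \<in> tuples \<Omega> m" "x \<in> X" "X = wl_rel `` {x}"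
  using assms self_in_class unfolding WL_eq_quotient by (blast elim: quotientE)

lemma partition_on_WL: "partition_on (tuples \<Omega> m) (WL m \<Omega> S)"
  unfolding WL_eq_quotient by (rule partition_on_quotient[OF equiv_wl_rel])

lemma reindex_WL_class:
  assumes "x \<in> tuples \<Omega> m" "\<sigma> \<in> {..<m} \<rightarrow> {..<m}"
  shows "reindex \<sigma> ` (wl_rel `` {x}) = wl_rel `` {reindex \<sigma> x}"
proof
  show "reindex \<sigma> ` (wl_rel `` {x}) \<subseteq> wl_rel `` {reindex \<sigma> x}"
    using wl_rel_reindex[OF _ assms(2)] by auto
  show "wl_rel `` {reindex \<sigma> x} \<subseteq> reindex \<sigma> ` (wl_rel `` {x})"
    using wl_rel_lift_reindex[OF _ assms] by blast
qed

lemma mary_coherent_configuration_WL: "mary_coherent_configuration m \<Omega> (WL m \<Omega> S)"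
  unfolding mary_coherent_configuration_def
proof (intro conjI ballI)
  show "finite \<Omega>" by (rule fin_single)
  show "partition_on (tuples \<Omega> m) (WL m \<Omega> S)" by (rule partition_on_WL)
next
  fix X x y assume "X \<in> WL m \<Omega> S" "x \<in> X" "y \<in> X"
  then have "(x, y) \<in> wl_rel" using WL_class_eq by blast
  then show "eq_pattern x = eq_pattern y"
    using wl_relD(3-5)[of x y] by (auto simp: eq_pattern_def compatible_def)
next
  fix X \<sigma> assume "X \<in> WL m \<Omega> S" and \<sigma>: "\<sigma> \<in> {..<m} \<rightarrow> {..<m}"
  then obtain x where x: "x \<in> tuples \<Omega> m" "X = wl_rel `` {x}" by (metis WL_classE)
  show "reindex \<sigma> ` X \<in> WL m \<Omega> S"
    unfolding x(2) reindex_WL_class[OF x(1) \<sigma>] by (intro WL_class_mem tuples_reindex x \<sigma>)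
next
  fix X\<^sub>0 Xs assume X: "X\<^sub>0 \<in> WL m \<Omega> S" "Xs \<in> tuples (WL m \<Omega> S) m"
  have "extension_count \<Omega> Xs x = extension_count \<Omega> Xs y" if "x \<in> X\<^sub>0" "y \<in> X\<^sub>0" for x y
  proof -
    have "(x, y) \<in> wl_rel" using WL_class_eq X that by blast
    then obtain \<beta> where \<beta>: "bij_betw \<beta> \<Omega> \<Omega>"
      "\<And>\<alpha> i. \<alpha> \<in> \<Omega> \<Longrightarrow> i < m \<Longrightarrow> (x[i := \<alpha>], y[i := \<beta> \<alpha>]) \<in> wl_rel"
      using stable_rel_bij[OF stable_rel_wl_rel] by metis
    have "x[i := \<alpha>] \<in> Xs ! i \<longleftrightarrow> y[i := \<beta> \<alpha>] \<in> Xs ! i" if "\<alpha> \<in> \<Omega>" "i < m" for \<alpha> i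
    proof -
      have "Xs ! i \<in> WL m \<Omega> S" using X(2) that(2) by (rule tuplesD(2))
      then show ?thesis using \<beta>(2)[OF that] equiv_class_eq_iff[OF equiv_wl_rel] WL_class_eq
        by (metis Image_singleton_iff)
    qed
    then have "bij_betw \<beta> {\<alpha> \<in> \<Omega>. \<forall>i<length Xs. x[i := \<alpha>] \<in> Xs ! i}
        {\<alpha> \<in> \<Omega>. \<forall>i<length Xs. y[i := \<alpha>] \<in> Xs ! i}"
      using tuplesD(1)[OF X(2)] by (intro bij_betw_Collect[OF \<beta>(1)]) simp
    then show ?thesis unfolding extension_count_def by (rule bij_betw_same_card)
  qed
  then show "\<exists>c. \<forall>x\<in>X\<^sub>0. extension_count \<Omega> Xs x = c" by blast
qed

end


section \<open>Algebraic isomorphisms of higher arity\<close>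

lemma mary_intersection_number_eq:
  assumes "mary_coherent_configuration m \<Omega> \<X>" "X\<^sub>0 \<in> \<X>" "Xs \<in> tuples \<X> m" "x \<in> X\<^sub>0"
  shows "mary_intersection_number \<Omega> X\<^sub>0 Xs = extension_count \<Omega> Xs x"
proof -
  have "\<forall>X\<^sub>0\<in>\<X>. \<forall>Xs\<in>tuples \<X> m. \<exists>c. \<forall>x\<in>X\<^sub>0. extension_count \<Omega> Xs x = c"
    using assms(1) unfolding mary_coherent_configuration_def by (elim conjE)
  then obtain c where "\<forall>x\<in>X\<^sub>0. extension_count \<Omega> Xs x = c" using assms(2,3) by blast
  with assms(4) show ?thesis unfolding mary_intersection_number_def by (intro the_equality) auto
qed

locale mary_iso =
  fixes m :: nat and \<Omega> :: "'a set" and \<X> :: "'a list set set"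
    and \<Omega>' :: "'b set" and \<X>' :: "'b list set set" and \<psi> :: "'a list set \<Rightarrow> 'b list set"
  assumes iso: "mary_algebraic_isomorphism m \<Omega> \<X> \<Omega>' \<X>' \<psi>" and m2: "2 \<le> m"
begin

lemma iso_cc: "mary_coherent_configuration m \<Omega> \<X>" "mary_coherent_configuration m \<Omega>' \<X>'"
  and iso_bij: "bij_betw \<psi> \<X> \<X>'"
  and iso_reindex: "X \<in> \<X> \<Longrightarrow> \<sigma> \<in> {..<m} \<rightarrow> {..<m} \<Longrightarrow> \<psi> (reindex \<sigma> ` X) = reindex \<sigma> ` \<psi> X"
  and iso_number: "X\<^sub>0 \<in> \<X> \<Longrightarrow> Xs \<in> tuples \<X> m \<Longrightarrow>
    mary_intersection_number \<Omega> X\<^sub>0 Xs = mary_intersection_number \<Omega>' (\<psi> X\<^sub>0) (map \<psi> Xs)"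
  using iso unfolding mary_algebraic_isomorphism_def by blast+

lemma iso_finite: "finite \<Omega>" "finite \<Omega>'"
  and iso_partition: "partition_on (tuples \<Omega> m) \<X>" "partition_on (tuples \<Omega>' m) \<X>'"
  using iso_cc unfolding mary_coherent_configuration_def by auto

lemma class_reindex: "X \<in> \<X> \<Longrightarrow> \<sigma> \<in> {..<m} \<rightarrow> {..<m} \<Longrightarrow> reindex \<sigma> ` X \<in> \<X>"
  using iso_cc(1) unfolding mary_coherent_configuration_def by blast

lemma iso_class: "X \<in> \<X> \<Longrightarrow> \<psi> X \<in> \<X>'"
  using iso_bij by (auto simp: bij_betw_def)

lemma class_tuple: "X \<in> \<X> \<Longrightarrow> x \<in> X \<Longrightarrow> x \<in> tuples \<Omega> m"
  "X' \<in> \<X>' \<Longrightarrow> x' \<in> X' \<Longrightarrow> x' \<in> tuples \<Omega>' m"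
  using iso_partition by (auto simp: partition_on_def)

lemma class_eq: "X \<in> \<X> \<Longrightarrow> Y \<in> \<X> \<Longrightarrow> x \<in> X \<Longrightarrow> x \<in> Y \<Longrightarrow> X = Y"
  "X' \<in> \<X>' \<Longrightarrow> Y' \<in> \<X>' \<Longrightarrow> x' \<in> X' \<Longrightarrow> x' \<in> Y' \<Longrightarrow> X' = Y'"
  using iso_partition partition_on_class_eq by metis+

text \<open>Coordinates \<open>i\<close> and \<open>j\<close> agree on a class iff the class is fixed by the map sending \<open>j\<close> to \<open>i\<close>.\<close>

lemma reindex_collapse_iff:
  assumes cc: "mary_coherent_configuration m \<Omega>0 \<Y>" and X: "X \<in> \<Y>" "x \<in> X" and ij: "i < m" "j < m"
  shows "reindex (id(j := i)) ` X = X \<longleftrightarrow> x ! i = x ! j"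
proof -
  have part: "partition_on (tuples \<Omega>0 m) \<Y>"
    and pat: "\<And>y. y \<in> X \<Longrightarrow> eq_pattern y = eq_pattern x"
    using cc X unfolding mary_coherent_configuration_def by blast+
  have len: "length y = m" if "y \<in> X" for y
    using part X(1) that by (auto simp: partition_on_def tuples_def)
  show ?thesis
  proof
    assume "reindex (id(j := i)) ` X = X"
    then obtain y where "y \<in> X" "x = reindex (id(j := i)) y" using X(2) by blast
    then show "x ! i = x ! j" using len[of y] ij by auto
  next
    assume "x ! i = x ! j"
    then have "(i, j) \<in> eq_pattern x" using len[OF X(2)] ij by (simp add: eq_pattern_def)
    then have "y ! i = y ! j" if "y \<in> X" for y using pat[OF that] by (auto simp: eq_pattern_def)
    then have "reindex (id(j := i)) y = y" if "y \<in> X" for y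
      using len[OF that] that by (intro nth_equalityI) auto
    then show "reindex (id(j := i)) ` X = X" by simp
  qed
qed

text \<open>Since \<open>\<psi>\<close> commutes with reindexing and is injective, a class and its
  image satisfy the fixed-point condition of \<open>reindex_collapse_iff\<close>
  simultaneously.\<close>

lemma iso_eq_iff:
  assumes "X \<in> \<X>" "x \<in> X" "x' \<in> \<psi> X" "i < m" "j < m"
  shows "x ! i = x ! j \<longleftrightarrow> x' ! i = x' ! j"
proof -
  have \<sigma>: "id(j := i) \<in> {..<m} \<rightarrow> {..<m}" using assms by auto
  have "reindex (id(j := i)) ` X \<in> \<X>"
    by (rule class_reindex[OF assms(1) \<sigma>])
  then have "reindex (id(j := i)) ` X = X \<longleftrightarrow> \<psi> (reindex (id(j := i)) ` X) = \<psi> X"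
    using assms(1) iso_bij by (auto simp: bij_betw_def inj_on_def)
  then show ?thesis
    using reindex_collapse_iff[OF iso_cc(1) assms(1,2,4,5)] iso_reindex[OF assms(1) \<sigma>]
      reindex_collapse_iff[OF iso_cc(2) iso_class[OF assms(1)] assms(3-5)] by simp
qed

text \<open>A class is determined by its 2-projection up to the reindexing \<open>(x\<^sub>0, x\<^sub>1, \<dots>) \<mapsto> (x\<^sub>0, x\<^sub>1, x\<^sub>1, \<dots>)\<close>;
  hence the 2-projection of \<open>\<psi>\<close> is well defined.\<close>

lemma two_projection_pr2:
  assumes X: "X \<in> \<X>"
  shows "two_projection \<X> \<psi> (pr2 X) = pr2 (\<psi> X)"
  unfolding two_projection_def
proof (rule the_equality)
  show "\<exists>Xa\<in>\<X>. pr2 Xa = pr2 X \<and> pr2 (\<psi> Xa) = pr2 (\<psi> X)" using X by blast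
  fix v assume "\<exists>Y\<in>\<X>. pr2 Y = pr2 X \<and> pr2 (\<psi> Y) = v"
  then obtain Y where Y: "Y \<in> \<X>" "pr2 Y = pr2 X" "v = pr2 (\<psi> Y)" by blast
  define \<sigma> where "\<sigma> i = (if i = 0 then 0 else 1::nat)" for i :: nat
  have \<sigma>: "\<sigma> \<in> {..<m} \<rightarrow> {..<m}" using m2 by (auto simp: \<sigma>_def)
  have eq: "reindex \<sigma> ` Z = (\<lambda>(a, b). a # replicate (m - 1) b) ` pr2 Z" if "Z \<in> \<X>" for Z
    unfolding pr2_def image_image
  proof (rule image_cong[OF refl])
    fix z assume "z \<in> Z"
    then have "length z = m" using class_tuple(1)[OF that] by (auto dest: tuplesD)
    then show "reindex \<sigma> z = (case (z ! 0, z ! 1) of (a, b) \<Rightarrow> a # replicate (m - 1) b)"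
      using m2 by (auto intro!: nth_equalityI simp: nth_Cons' \<sigma>_def)
  qed
  have pr2: "pr2 (reindex \<sigma> ` Z) = pr2 Z" if "Z \<in> \<X>'" for Z
    unfolding pr2_def image_image
  proof (rule image_cong[OF refl])
    fix z assume "z \<in> Z"
    then have "length z = m" using class_tuple(2)[OF that] by (auto dest: tuplesD)
    then show "(reindex \<sigma> z ! 0, reindex \<sigma> z ! 1) = (z ! 0, z ! 1)"
      using m2 by (simp add: \<sigma>_def)
  qed
  \<comment> \<open>\<open>X\<close> and \<open>Y\<close> may be different classes, but equal
    2-projections give equal reindexed classes, and \<open>\<psi>\<close> commutes with the
    reindexing.\<close>
  have "reindex \<sigma> ` \<psi> Y = reindex \<sigma> ` \<psi> X"
    using iso_reindex[OF X \<sigma>] iso_reindex[OF Y(1) \<sigma>] eq[OF X] eq[OF Y(1)] Y(2) by simp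
  then show "v = pr2 (\<psi> X)" using pr2[OF iso_class[OF X]] pr2[OF iso_class[OF Y(1)]] Y(3) by simp
qed

definition iso_rel :: "('a list \<times> 'b list) set" where
  "iso_rel = {(x, x'). \<exists>X\<in>\<X>. x \<in> X \<and> x' \<in> \<psi> X}"

lemma iso_rel_tuples: "iso_rel \<subseteq> tuples \<Omega> m \<times> tuples \<Omega>' m"
  using class_tuple(1) class_tuple(2)[OF iso_class] by (auto simp: iso_rel_def)

lemma iso_rel_support: "Domain iso_rel = tuples \<Omega> m" "Range iso_rel = tuples \<Omega>' m"
proof -
  have "x \<in> Domain iso_rel" if x: "x \<in> tuples \<Omega> m" for x
  proof -
    obtain X where X: "X \<in> \<X>" "x \<in> X" using partition_on_class[OF iso_partition(1) x] by blast
    have "\<psi> X \<noteq> {}" using iso_class[OF X(1)] iso_partition(2) by (auto simp: partition_on_def)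
    then show ?thesis using X by (auto simp: iso_rel_def)
  qed
  moreover have "x' \<in> Range iso_rel" if x': "x' \<in> tuples \<Omega>' m" for x'
  proof -
    obtain X' where X': "X' \<in> \<X>'" "x' \<in> X'" using partition_on_class[OF iso_partition(2) x'] by blast
    then obtain X where X: "X \<in> \<X>" "\<psi> X = X'" using iso_bij by (auto simp: bij_betw_def)
    have "X \<noteq> {}" using X(1) iso_partition(1) by (auto simp: partition_on_def)
    then show ?thesis using X X' by (auto simp: iso_rel_def)
  qed
  ultimately show "Domain iso_rel = tuples \<Omega> m" "Range iso_rel = tuples \<Omega>' m"
    using iso_rel_tuples by auto
qed

text \<open>An intersection number counts the points that extend a tuple with a prescribed vector of
  classes. Equal counts for every vector amount to equal multisets of vectors, hence to a bijection
  by \<open>image_mset_set_eq_iff\<close>.\<close>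

lemma iso_rel_bij:
  assumes "(x, x') \<in> iso_rel"
  shows "\<exists>\<beta>. bij_betw \<beta> \<Omega> \<Omega>' \<and> (\<forall>\<alpha>\<in>\<Omega>. \<forall>i<m. (x[i := \<alpha>], x'[i := \<beta> \<alpha>]) \<in> iso_rel)"
proof -
  obtain X\<^sub>0 where X0: "X\<^sub>0 \<in> \<X>" "x \<in> X\<^sub>0" "x' \<in> \<psi> X\<^sub>0" using assms by (auto simp: iso_rel_def)
  have x: "x \<in> tuples \<Omega> m" "x' \<in> tuples \<Omega>' m" using assms iso_rel_tuples by auto
  have "\<forall>y\<in>tuples \<Omega> m. \<exists>X\<in>\<X>. y \<in> X" "\<forall>y\<in>tuples \<Omega>' m. \<exists>X\<in>\<X>'. y \<in> X"
    by (intro ballI partition_on_class[OF iso_partition(1)] partition_on_class[OF iso_partition(2)]; assumption)+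
  then obtain cl cl' where cl: "\<And>y. y \<in> tuples \<Omega> m \<Longrightarrow> cl y \<in> \<X> \<and> y \<in> cl y"
    and cl': "\<And>y. y \<in> tuples \<Omega>' m \<Longrightarrow> cl' y \<in> \<X>' \<and> y \<in> cl' y" by metis
  have cl_eq: "X = cl y \<longleftrightarrow> y \<in> X" if "X \<in> \<X>" "y \<in> tuples \<Omega> m" for X y
    using cl[OF that(2)] class_eq(1) that by blast
  have cl'_eq: "X = cl' y \<longleftrightarrow> y \<in> X" if "X \<in> \<X>'" "y \<in> tuples \<Omega>' m" for X y
    using cl'[OF that(2)] class_eq(2) that by blast
  \<comment> \<open>Classes on the first side are pushed forward by \<open>\<psi>\<close>, so that
    both vectors consist of classes in \<open>\<X>'\<close>.\<close>
  define f where "f \<alpha> = map (\<lambda>i. \<psi> (cl (x[i := \<alpha>]))) [0..<m]" for \<alpha>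
  define g where "g \<alpha> = map (\<lambda>i. cl' (x'[i := \<alpha>])) [0..<m]" for \<alpha>
  have "card {\<alpha> \<in> \<Omega>. f \<alpha> = C} = card {\<alpha> \<in> \<Omega>'. g \<alpha> = C}" for C
  proof (cases "C \<in> tuples \<X>' m")
    case False
    have "f \<alpha> \<in> tuples \<X>' m" if "\<alpha> \<in> \<Omega>" for \<alpha>
      using cl[OF tuples_update[OF x(1) that]] iso_class by (auto simp: f_def tuples_def)
    moreover have "g \<alpha> \<in> tuples \<X>' m" if "\<alpha> \<in> \<Omega>'" for \<alpha>
      using cl'[OF tuples_update[OF x(2) that]] by (auto simp: g_def tuples_def)
    ultimately have "{\<alpha> \<in> \<Omega>. f \<alpha> = C} = {}" "{\<alpha> \<in> \<Omega>'. g \<alpha> = C} = {}" using False by auto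
    then show ?thesis by (metis card.empty)
  next
    case True
    \<comment> \<open>The intersection numbers on the first side take classes in
      \<open>\<X>\<close>, so \<open>C\<close> is pulled back along \<open>\<psi>\<close>.\<close>
    define Xs where "Xs = map (inv_into \<X> \<psi>) C"
    have inv: "inv_into \<X> \<psi> X \<in> \<X>" "\<psi> (inv_into \<X> \<psi> X) = X" if "X \<in> \<X>'" for X
      using that iso_bij by (auto simp: bij_betw_def inv_into_into f_inv_into_f)
    have Xs: "Xs \<in> tuples \<X> m" "map \<psi> Xs = C"
      using True inv by (auto simp: Xs_def tuples_def map_idI subset_iff)
    note lC = tuplesD(1)[OF True] and lXs = tuplesD(1)[OF Xs(1)]
    have "f \<alpha> = C \<longleftrightarrow> (\<forall>i<length Xs. x[i := \<alpha>] \<in> Xs ! i)" if "\<alpha> \<in> \<Omega>" for \<alpha>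
    proof -
      have "f \<alpha> = C \<longleftrightarrow> (\<forall>i<m. \<psi> (cl (x[i := \<alpha>])) = \<psi> (Xs ! i))"
        unfolding Xs(2)[symmetric] f_def list_eq_iff_nth_eq using lXs by simp
      also have "\<dots> \<longleftrightarrow> (\<forall>i<m. Xs ! i = cl (x[i := \<alpha>]))"
        using cl[OF tuples_update[OF x(1) that]] tuplesD(2)[OF Xs(1)] iso_bij
        unfolding bij_betw_def inj_on_def by metis
      also have "\<dots> \<longleftrightarrow> (\<forall>i<m. x[i := \<alpha>] \<in> Xs ! i)"
        using cl_eq[OF tuplesD(2)[OF Xs(1)] tuples_update[OF x(1) that]] by simp
      finally show ?thesis using lXs by simp
    qed
    then have 1: "{\<alpha> \<in> \<Omega>. f \<alpha> = C} = {\<alpha> \<in> \<Omega>. \<forall>i<length Xs. x[i := \<alpha>] \<in> Xs ! i}" by blast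
    have "g \<alpha> = C \<longleftrightarrow> (\<forall>i<length C. x'[i := \<alpha>] \<in> C ! i)" if "\<alpha> \<in> \<Omega>'" for \<alpha>
    proof -
      have "g \<alpha> = C \<longleftrightarrow> (\<forall>i<m. C ! i = cl' (x'[i := \<alpha>]))"
        unfolding g_def list_eq_iff_nth_eq using lC by auto
      also have "\<dots> \<longleftrightarrow> (\<forall>i<m. x'[i := \<alpha>] \<in> C ! i)"
        using cl'_eq[OF tuplesD(2)[OF True] tuples_update[OF x(2) that]] by simp
      finally show ?thesis using lC by simp
    qed
    then have 2: "{\<alpha> \<in> \<Omega>'. g \<alpha> = C} = {\<alpha> \<in> \<Omega>'. \<forall>i<length C. x'[i := \<alpha>] \<in> C ! i}" by blast
    have "extension_count \<Omega> Xs x = extension_count \<Omega>' C x'"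
      using iso_number[OF X0(1) Xs(1)] Xs(2) mary_intersection_number_eq[OF iso_cc(1) X0(1) Xs(1) X0(2)]
        mary_intersection_number_eq[OF iso_cc(2) iso_class[OF X0(1)] True X0(3)] by simp
    then show ?thesis unfolding 1 2 extension_count_def .
  qed
  then have "image_mset f (mset_set \<Omega>) = image_mset g (mset_set \<Omega>')"
    by (intro multiset_eqI) (simp add: count_image_mset_set iso_finite)
  then obtain \<beta> where \<beta>: "bij_betw \<beta> \<Omega> \<Omega>'" "\<And>\<alpha>. \<alpha> \<in> \<Omega> \<Longrightarrow> f \<alpha> = g (\<beta> \<alpha>)"
    using image_mset_set_eq_iff[OF iso_finite] by metis
  have "(x[i := \<alpha>], x'[i := \<beta> \<alpha>]) \<in> iso_rel" if "\<alpha> \<in> \<Omega>" "i < m" for \<alpha> i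
  proof -
    have t: "x[i := \<alpha>] \<in> tuples \<Omega> m" "x'[i := \<beta> \<alpha>] \<in> tuples \<Omega>' m"
      using tuples_update[OF x(1) that(1)] tuples_update[OF x(2) bij_betw_apply[OF \<beta>(1) that(1)]] by simp_all
    have "\<psi> (cl (x[i := \<alpha>])) = cl' (x'[i := \<beta> \<alpha>])"
      using \<beta>(2)[OF that(1)] that(2) by (simp add: f_def g_def)
    then show ?thesis using cl[OF t(1)] cl'[OF t(2)] by (auto simp: iso_rel_def)
  qed
  with \<beta>(1) show ?thesis by blast
qed

end


section \<open>The pebble game\<close>

text \<open>Winning is a condition on pairs of pebbles: the equality clause makes
  \<open>ran p\<close> the graph of a bijection, and the relation clause transports each basis
  relation both ways.\<close>

lemma winning_positionI:
  assumes "\<And>a b c d. (a, b) \<in> ran p \<Longrightarrow> (c, d) \<in> ran p \<Longrightarrow>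
    (a = c \<longleftrightarrow> b = d) \<and> (\<forall>s\<in>S. (a, c) \<in> s \<longleftrightarrow> (b, d) \<in> \<phi> s)"
  shows "winning_position S \<phi> p"
proof -
  define f where "f a = (SOME b. (a, b) \<in> ran p)" for a
  have f: "f a = b" if "(a, b) \<in> ran p" for a b
    unfolding f_def using assms that by (intro some_equality) blast+
  have "bij_betw f (fst ` ran p) (snd ` ran p)"
    unfolding bij_betw_def inj_on_def using f assms by (force simp: image_iff)
  moreover have "map_prod f f ` restrict_rel s (fst ` ran p) = restrict_rel (\<phi> s) (snd ` ran p)"
    if "s \<in> S" for s
  proof (intro equalityI subsetI)
    fix z assume "z \<in> map_prod f f ` restrict_rel s (fst ` ran p)"
    then obtain a b c d where "(a, b) \<in> ran p" "(c, d) \<in> ran p" "(a, c) \<in> s" "z = (f a, f c)"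
      by (auto simp: restrict_rel_def)
    moreover from this have "(b, d) \<in> \<phi> s" using assms that by blast
    ultimately show "z \<in> restrict_rel (\<phi> s) (snd ` ran p)"
      using f[of a b] f[of c d] image_eqI[of b snd "(a, b)"] image_eqI[of d snd "(c, d)"]
      by (simp add: restrict_rel_def)
  next
    fix z assume "z \<in> restrict_rel (\<phi> s) (snd ` ran p)"
    then obtain a b c d where h: "(a, b) \<in> ran p" "(c, d) \<in> ran p" "(b, d) \<in> \<phi> s" "z = (b, d)"
      by (auto simp: restrict_rel_def)
    then have "(a, c) \<in> s" using assms that by blast
    then have "(a, c) \<in> restrict_rel s (fst ` ran p)" "z = map_prod f f (a, c)"
      using h f[of a b] f[of c d] image_eqI[of a fst "(a, b)"] image_eqI[of c fst "(c, d)"]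
      by (simp_all add: restrict_rel_def)
    then show "z \<in> map_prod f f ` restrict_rel s (fst ` ran p)" by blast
  qed
  ultimately show ?thesis unfolding winning_position_def Let_def using f by blast
qed

text \<open>The game constrains \<open>s\<close> only when its restriction is nonempty, so
  membership is transported forward here; the converse comes from the partitions in
  \<open>winning_compatible\<close>.\<close>

lemma winning_positionD:
  assumes "winning_position S \<phi> p" "(a, b) \<in> ran p" "(c, d) \<in> ran p"
  shows "a = c \<longleftrightarrow> b = d" "s \<in> S \<Longrightarrow> (a, c) \<in> s \<Longrightarrow> (b, d) \<in> \<phi> s"
proof -
  obtain f where f: "\<forall>(a, b)\<in>ran p. f a = b" "bij_betw f (fst ` ran p) (snd ` ran p)"
    "\<forall>s\<in>S. restrict_rel s (fst ` ran p) \<noteq> {} \<longrightarrow>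
       map_prod f f ` restrict_rel s (fst ` ran p) = restrict_rel (\<phi> s) (snd ` ran p)"
    using assms(1) unfolding winning_position_def Let_def by blast
  have fab: "f a = b" "f c = d" using f(1) assms by auto
  have mem: "a \<in> fst ` ran p" "c \<in> fst ` ran p" using assms by force+
  show "a = c \<longleftrightarrow> b = d" using f(2) fab mem by (auto simp: bij_betw_def inj_on_def)
  assume s: "s \<in> S" "(a, c) \<in> s"
  then have "(a, c) \<in> restrict_rel s (fst ` ran p)" using mem by (simp add: restrict_rel_def)
  then have "map_prod f f (a, c) \<in> restrict_rel (\<phi> s) (snd ` ran p)" using f(3) s(1) by blast
  then show "(b, d) \<in> \<phi> s" using fab by (simp add: restrict_rel_def)
qed

text \<open>Duplicator's invariant: whichever pebble Spoiler picks up next, the pairs of points covered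
  by the other pebbles all occur in a single pair of \<open>m\<close>-tuples in \<open>E\<close>.\<close>

definition guarded :: "nat \<Rightarrow> ('a list \<times> 'b list) set \<Rightarrow> ('a, 'b) position \<Rightarrow> bool" where
  "guarded m E p \<longleftrightarrow> dom p \<subseteq> {..m} \<and>
     (\<forall>j\<le>m. \<exists>(y, y')\<in>E. ran (p(j := None)) \<subseteq> set (zip y y'))"

lemma guardedD:
  assumes "guarded m E p" "j \<le> m"
  obtains y y' where "(y, y') \<in> E" "ran (p(j := None)) \<subseteq> set (zip y y')"
  using assms unfolding guarded_def by blast

lemma ran_upd_None_subset: "ran (p(j := None)) \<subseteq> ran p"
  by (auto simp: ran_def)

lemma ran_upd_Some: "ran (p(i \<mapsto> v)) = insert v (ran (p(i := None)))"
  by (auto simp: ran_def)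

lemma ran_initial_position:
  "length x' = length x \<Longrightarrow> ran (initial_position x x') = set (zip x x')"
  by (auto simp: ran_def initial_position_def set_zip)

lemma dom_initial_position: "dom (initial_position x x') = {..<length x}"
  by (auto simp: initial_position_def dom_def)

section \<open>Duplicator's strategy from a stable relation\<close>

lemma guarded_initial_position:
  assumes "stable_rel m \<Omega> S \<Omega>' \<phi> E" "(x, x') \<in> E"
  shows "guarded m E (initial_position x x')"
proof -
  note D = stable_relD[OF assms]
  have "ran ((initial_position x x')(j := None)) \<subseteq> set (zip x x')" for j
    using ran_upd_None_subset[of "initial_position x x'" j] ran_initial_position[of x' x] D(3,4) by simp
  then show ?thesis using assms(2) D(3) by (auto simp: guarded_def dom_initial_position)
qed

text \<open>The pebbles other than \<open>i\<close> are covered by a related pair, whose bijection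
  is the reply. If \<open>j\<close> is lifted next, the pebbles other than \<open>i\<close> and
  \<open>j\<close> cover at most m - 1 pairs, so one entry of that related pair is free for the new
  pair.\<close>

lemma guarded_step:
  assumes E: "stable_rel m \<Omega> S \<Omega>' \<phi> E" and p: "guarded m E p" and i: "i \<le> m"
  shows "\<exists>\<beta>. bij_betw \<beta> \<Omega> \<Omega>' \<and> (\<forall>\<alpha>\<in>\<Omega>. guarded m E (p(i \<mapsto> (\<alpha>, \<beta> \<alpha>))))"
proof -
  obtain y y' where y: "(y, y') \<in> E" "ran (p(i := None)) \<subseteq> set (zip y y')" using guardedD[OF p i] .
  note D = stable_relD[OF E y(1)]
  obtain \<beta> where \<beta>: "bij_betw \<beta> \<Omega> \<Omega>'"
    "\<And>\<alpha> i. \<alpha> \<in> \<Omega> \<Longrightarrow> i < m \<Longrightarrow> (y[i := \<alpha>], y'[i := \<beta> \<alpha>]) \<in> E"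
    using stable_rel_bij[OF E y(1)] by metis
  have "guarded m E (p(i \<mapsto> (\<alpha>, \<beta> \<alpha>)))" if \<alpha>: "\<alpha> \<in> \<Omega>" for \<alpha>
    unfolding guarded_def
  proof (intro conjI allI impI)
    show "dom (p(i \<mapsto> (\<alpha>, \<beta> \<alpha>))) \<subseteq> {..m}" using p i by (auto simp: guarded_def)
    fix j assume j: "j \<le> m"
    show "\<exists>(y, y')\<in>E. ran ((p(i \<mapsto> (\<alpha>, \<beta> \<alpha>)))(j := None)) \<subseteq> set (zip y y')"
    proof (cases "j = i")
      \<comment> \<open>Lifting the pebble just placed gives back the old covering pair.\<close>
      case True
      then show ?thesis using y by auto
    next
      case False
      define P where "P = ran (p(j := None, i := None))"
      have "P \<subseteq> (\<lambda>k. the (p k)) ` ({..m} - {i, j})"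
      proof
        fix v assume "v \<in> P"
        then obtain k where k: "k \<noteq> i" "k \<noteq> j" "p k = Some v"
          by (auto simp: P_def ran_def split: if_splits)
        then have "k \<le> m" using p by (auto simp: guarded_def)
        with k show "v \<in> (\<lambda>k. the (p k)) ` ({..m} - {i, j})"
          by (intro image_eqI[of _ _ k]) auto
      qed
      then have "card P \<le> card ((\<lambda>k. the (p k)) ` ({..m} - {i, j}))" by (intro card_mono) auto
      also have "\<dots> \<le> card ({..m} - {i, j})" by (rule card_image_le) simp
      also have "\<dots> = m - 1" using i j False by (simp add: card_Diff_subset)
      also have "\<dots> < m" using i j False by linarith
      finally have cP: "card P < m" .
      have "P \<subseteq> set (zip y y')" using y(2) by (auto simp: P_def ran_def split: if_splits)
      then obtain k where k: "k < m" "\<And>a b. insert (a, b) P \<subseteq> set (zip (y[k := a]) (y'[k := b]))"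
        using zip_update_covers[OF D(3,4) _ cP] by metis
      have "ran ((p(i \<mapsto> (\<alpha>, \<beta> \<alpha>)))(j := None)) = insert (\<alpha>, \<beta> \<alpha>) P"
        using False by (simp add: P_def fun_upd_twist[of i j] ran_upd_Some)
      then show ?thesis using \<beta>(2)[OF \<alpha> k(1)] k(2)
        by (intro bexI[of _ "(y[k := \<alpha>], y'[k := \<beta> \<alpha>])"]) simp_all
    qed
  qed
  with \<beta>(1) show ?thesis by blast
qed

text \<open>With at least three pebbles, any two of them avoid some \<open>j\<close>, so the
  invariant for \<open>j\<close> puts both into one compatible pair of tuples.\<close>

lemma guarded_winning:
  assumes E: "stable_rel m \<Omega> S \<Omega>' \<phi> E" and p: "guarded m E p" and m: "2 \<le> m"
  shows "winning_position S \<phi> p"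
proof (rule winning_positionI)
  fix a b c d assume "(a, b) \<in> ran p" "(c, d) \<in> ran p"
  then obtain i k where ik: "p i = Some (a, b)" "p k = Some (c, d)" by (auto simp: ran_def)
  have "card {i, k} < card {..m}" using m by (simp add: card_insert_if)
  then obtain j where j: "j \<le> m" "j \<noteq> i" "j \<noteq> k"
    by (metis atMost_iff card_mono finite.emptyI finite_insert insertCI not_less subsetI)
  obtain y y' where y: "(y, y') \<in> E" "ran (p(j := None)) \<subseteq> set (zip y y')" using guardedD[OF p j(1)] .
  note D = stable_relD[OF E y(1)]
  have "(a, b) \<in> ran (p(j := None))" "(c, d) \<in> ran (p(j := None))"
    using ik j by (auto simp: ran_def)
  then have mem: "(a, b) \<in> set (zip y y')" "(c, d) \<in> set (zip y y')" using y(2) by blast+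
  have "length y' = length y" using D by simp
  from compatibleD[OF D(5) this mem]
  show "(a = c \<longleftrightarrow> b = d) \<and> (\<forall>s\<in>S. (a, c) \<in> s \<longleftrightarrow> (b, d) \<in> \<phi> s)" by blast
qed

lemma duplicator_wins_if_stable:
  fixes E :: "('a list \<times> 'b list) set"
  assumes E: "stable_rel m \<Omega> S \<Omega>' \<phi> E" and x: "(x, x') \<in> E" and m: "2 \<le> m"
  shows "duplicator_wins (m + 1) \<Omega> S \<Omega>' \<phi> x x'"
proof -
  define pos where "pos = position_after (initial_position x x')"
  \<comment> \<open>The bijection depends on the history and the pebble in hand, not on Spoiler's
    set, so the replies to sets and to points fit together.\<close>
  define \<beta> where "\<beta> h i = (SOME \<beta>. bij_betw \<beta> \<Omega> \<Omega>' \<and>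
    (\<forall>\<alpha>\<in>\<Omega>. guarded m E ((pos h)(i \<mapsto> (\<alpha>, \<beta> \<alpha>)))))" for h i
  have \<beta>: "bij_betw (\<beta> h i) \<Omega> \<Omega>'" "\<And>\<alpha>. \<alpha> \<in> \<Omega> \<Longrightarrow> guarded m E ((pos h)(i \<mapsto> (\<alpha>, \<beta> h i \<alpha>)))"
    if "guarded m E (pos h)" "i < m + 1" for h i
    using someI_ex[OF guarded_step[OF E that(1), of i]] that(2) unfolding \<beta>_def by auto
  define D :: "('a, 'b) strategy" where
    "D = \<lparr>set1 = \<lambda>h i A'. \<beta> h i ` A', point1 = \<lambda>h i A' b. inv_into \<Omega> (\<beta> h i) b,
          set2 = \<lambda>h i A'. inv_into \<Omega> (\<beta> h i) ` A', point2 = \<lambda>h i A' a. \<beta> h i a\<rparr>"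
  have inv: "guarded m E (pos h)" if "h \<in> plays (m + 1) \<Omega> \<Omega>' D" for h
    using that
  proof (induction rule: plays.induct)
    case start
    then show ?case using guarded_initial_position[OF E x] by (simp add: pos_def)
  next
    case (round1 h i A' b)
    then obtain a where a: "a \<in> \<Omega>" "b = \<beta> h i a" by (auto simp: D_def)
    then have "inv_into \<Omega> (\<beta> h i) b = a"
      using \<beta>(1)[OF round1.IH round1.hyps(2)] by (simp add: bij_betw_def)
    then show ?case using \<beta>(2)[OF round1.IH round1.hyps(2) a(1)] a by (simp add: pos_def D_def fun_upd_def)
  next
    case (round2 h i A' a)
    then have "a \<in> \<Omega>"
      using bij_betw_inv_into[OF \<beta>(1)[OF round2.IH round2.hyps(2)]]
      by (auto simp: D_def bij_betw_def)
    then show ?case using \<beta>(2)[OF round2.IH round2.hyps(2)] by (simp add: pos_def D_def fun_upd_def)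
  qed
  have legal: "legal_after (m + 1) \<Omega> \<Omega>' D h" if "guarded m E (pos h)" for h
    unfolding legal_after_def
  proof (intro conjI allI impI)
    fix i A' assume i: "i < m + 1" and A': "A' \<subseteq> \<Omega>"
    note b = \<beta>(1)[OF that i]
    have inj: "inj_on (\<beta> h i) A'" using b A' by (auto simp: bij_betw_def intro: inj_on_subset)
    show "set1 D h i A' \<subseteq> \<Omega>'" using b A' by (auto simp: D_def bij_betw_def)
    show "card (set1 D h i A') = card A'" using card_image[OF inj] by (simp add: D_def)
    show "\<forall>b\<in>set1 D h i A'. point1 D h i A' b \<in> A'"
      using b A' by (auto simp: D_def bij_betw_def subset_iff)
  next
    fix i A' assume i: "i < m + 1" and A': "A' \<subseteq> \<Omega>'"
    note b = \<beta>(1)[OF that i] and b' = bij_betw_inv_into[OF \<beta>(1)[OF that i]]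
    have inj: "inj_on (inv_into \<Omega> (\<beta> h i)) A'"
      using b' A' by (auto simp: bij_betw_def intro: inj_on_subset)
    show "set2 D h i A' \<subseteq> \<Omega>" using b' A' by (auto simp: D_def bij_betw_def)
    show "card (set2 D h i A') = card A'" using card_image[OF inj] by (simp add: D_def)
    show "\<forall>a\<in>set2 D h i A'. point2 D h i A' a \<in> A'"
      using b A' by (auto simp: D_def bij_betw_inv_into_right subset_iff)
  qed
  show ?thesis unfolding duplicator_wins_def
    using legal inv guarded_winning[OF E _ m] unfolding pos_def by blast
qed

section \<open>Spoiler's detection of colour differences\<close>

lemma dom_position_after:
  assumes "h \<in> plays k \<Omega> \<Omega>' D" "length x \<le> k"
  shows "dom (position_after (initial_position x x') h) \<subseteq> {..<k}"
  using assms by (induction rule: plays.induct) (auto simp: dom_initial_position)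

text \<open>One pebble per pair in \<open>ps\<close> uses at most m of the m + 1 pebbles, so another
  can be lifted without uncovering any of these pairs.\<close>

lemma spare_pebble:
  assumes "set ps \<subseteq> ran p" "dom p \<subseteq> {..m}" "length ps = m"
  obtains j where "j \<le> m" "set ps \<subseteq> ran (p(j := None))"
proof -
  have "\<forall>q\<in>set ps. \<exists>i\<le>m. p i = Some q" using assms(1,2) by (force simp: ran_def)
  then obtain g where g: "\<And>q. q \<in> set ps \<Longrightarrow> g q \<le> m \<and> p (g q) = Some q" by metis
  have "card (g ` set ps) \<le> m" using card_image_le[of "set ps" g] card_length[of ps] assms(3) by simp
  then have "card (g ` set ps) < card {..m}" by simp
  moreover have "g ` set ps \<subseteq> {..m}" using g by auto
  ultimately obtain j where j: "j \<le> m" "j \<notin> g ` set ps"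
    by (metis atMost_iff less_irrefl subsetI subset_antisym)
  have "set ps \<subseteq> ran (p(j := None))"
  proof
    fix q assume q: "q \<in> set ps"
    then have "(p(j := None)) (g q) = Some q" using g j by auto
    then show "q \<in> ran (p(j := None))" by (rule ranI)
  qed
  with j(1) that show thesis by blast
qed

lemma set_zip_update_subset:
  "set (zip (y[i := a]) (y'[i := b])) \<subseteq> insert (a, b) (set (zip y y'))"
  unfolding zip_update by (rule set_update_subset_insert)

locale wl_cc_pair = wl_pair +
  assumes part: "partition_on (\<Omega> \<times> \<Omega>) S" "partition_on (\<Omega>' \<times> \<Omega>') S'" and m2: "2 \<le> m"
begin

text \<open>For the converse on relations, the pair on the first side lies in some \<open>t\<close>;
  going forward it lands in \<open>\<phi> t\<close>, so disjointness gives
  \<open>\<phi> s = \<phi> t\<close> and injectivity gives \<open>s = t\<close>.\<close>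

lemma winning_compatible:
  assumes "winning_position S \<phi> p" "set (zip y y') \<subseteq> ran p" "y \<in> tuples \<Omega> m" "y' \<in> tuples \<Omega>' m"
  shows "compatible S \<phi> y y'"
  unfolding compatible_def
proof (intro allI impI conjI ballI)
  note l = tuplesD(1)[OF assms(3)] tuplesD(1)[OF assms(4)]
  fix i j assume ij: "i < length y" "j < length y"
  then have mem: "(y ! i, y' ! i) \<in> ran p" "(y ! j, y' ! j) \<in> ran p"
    using assms(2) l by (auto simp: set_zip)
  note W = winning_positionD[OF assms(1) mem]
  show "y ! i = y ! j \<longleftrightarrow> y' ! i = y' ! j" by (rule W(1))
  fix s assume s: "s \<in> S"
  show "(y ! i, y ! j) \<in> s \<longleftrightarrow> (y' ! i, y' ! j) \<in> \<phi> s"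
  proof
    assume h: "(y' ! i, y' ! j) \<in> \<phi> s"
    have "(y ! i, y ! j) \<in> \<Omega> \<times> \<Omega>" using tuplesD(2)[OF assms(3)] ij l by simp
    then obtain t where t: "t \<in> S" "(y ! i, y ! j) \<in> t"
      using partition_on_class[OF part(1)] by blast
    then have "(y' ! i, y' ! j) \<in> \<phi> t" using W(2) by blast
    moreover have "\<phi> s \<in> S'" "\<phi> t \<in> S'" using s t bij by (auto simp: bij_betw_def)
    ultimately have "\<phi> s = \<phi> t" using h partition_on_class_eq[OF part(2)] by blast
    then have "s = t" using s t bij by (auto simp: bij_betw_def inj_on_def)
    then show "(y ! i, y ! j) \<in> s" using t by simp
  qed (use W(2) s in blast)
qed

text \<open>Spoiler plays the set of all points extending \<open>y\<close> by a prescribed vector of colours, so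
  Duplicator's replies compare the multiplicities of this vector on the two sides.\<close>

lemma winning_strategy_imp_wl_sim:
  assumes D: "\<And>h. h \<in> plays (m + 1) \<Omega> \<Omega>' D \<Longrightarrow> legal_after (m + 1) \<Omega> \<Omega>' D h \<and>
      winning_position S \<phi> (position_after (initial_position x x') h)"
    and x: "length x = m"
    and h: "h \<in> plays (m + 1) \<Omega> \<Omega>' D" and y: "y \<in> tuples \<Omega> m" "y' \<in> tuples \<Omega>' m"
    and sub: "set (zip y y') \<subseteq> ran (position_after (initial_position x x') h)"
  shows "wl_sim n y y'"
  using h y sub
proof (induction n arbitrary: h y y')
  case 0
  then have "compatible S \<phi> y y'" using winning_compatible D by blast
  then show ?case using wl_sim_0[of y' y] 0 by (simp add: tuplesD)
next
  case (Suc n)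
  note l = tuplesD(1)[OF Suc.prems(2)] tuplesD(1)[OF Suc.prems(3)]
  let ?p = "position_after (initial_position x x') h"
  have "dom ?p \<subseteq> {..m}" using dom_position_after[OF Suc.prems(1), of x x'] x by auto
  moreover have "length (zip y y') = m" using l by simp
  ultimately obtain j where j: "j \<le> m" "set (zip y y') \<subseteq> ran (?p(j := None))"
    using spare_pebble[OF Suc.prems(4)] by metis
  have j': "j < m + 1" using j by simp
  have legal: "legal_after (m + 1) \<Omega> \<Omega>' D h" using D Suc.prems(1) by blast
  define f where "f a = map (\<lambda>i. map_colour (translate_atom \<phi>) (wl_colour \<Omega> S n (y[i := a]))) [0..<m]" for a
  define g where "g b = map (\<lambda>i. wl_colour \<Omega>' S' n (y'[i := b])) [0..<m]" for b
  have fg: "f a = g b \<longleftrightarrow> (\<forall>i<m. wl_sim n (y[i := a]) (y'[i := b]))" for a b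
    by (simp add: f_def g_def wl_sim_def list_eq_iff_nth_eq)
  \<comment> \<open>With pebble \<open>j\<close> on \<open>(a, b)\<close>, all m updated pairs of
    tuples are covered at once, so the induction hypothesis applies to each of them at
    \<open>h'\<close>.\<close>
  have eqI: "f a = g b" if "h' \<in> plays (m + 1) \<Omega> \<Omega>' D" "a \<in> \<Omega>" "b \<in> \<Omega>'"
    and "position_after (initial_position x x') h' = ?p(j \<mapsto> (a, b))" for h' a b
    unfolding fg
  proof (intro allI impI)
    fix i assume "i < m"
    have "set (zip (y[i := a]) (y'[i := b])) \<subseteq> ran (?p(j \<mapsto> (a, b)))"
      using set_zip_update_subset[of y i a y' b] j(2) unfolding ran_upd_Some by blast
    then show "wl_sim n (y[i := a]) (y'[i := b])"
      using Suc.IH[OF that(1)] that(2-4) tuples_update Suc.prems(2,3) by metis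
  qed
  have "card {a \<in> \<Omega>. f a = C} = card {b \<in> \<Omega>'. g b = C}" for C
  proof (rule antisym)
    \<comment> \<open>Duplicator answers every point of her set inside \<open>A\<close>, so by
      \<open>eqI\<close> all of her set has vector \<open>C\<close>, and its size bounds the
      multiplicity on the second side from below.\<close>
    define A where "A = {a \<in> \<Omega>. f a = C}"
    have A: "A \<subseteq> \<Omega>" by (auto simp: A_def)
    have leg: "set1 D h j A \<subseteq> \<Omega>'" "card (set1 D h j A) = card A"
      "\<forall>b\<in>set1 D h j A. point1 D h j A b \<in> A"
      using conjunct1[OF legal[unfolded legal_after_def], THEN spec, THEN mp, OF j', THEN spec, THEN mp, OF A]
      by simp_all
    have "g b = C" if b: "b \<in> set1 D h j A" for b
    proof -
      have "f (point1 D h j A b) = g b"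
        by (rule eqI[OF plays.round1[OF Suc.prems(1) j' A b]]) (use leg b A in \<open>auto simp: fun_upd_def\<close>)
      then show ?thesis using leg(3) b by (auto simp: A_def)
    qed
    then have "set1 D h j A \<subseteq> {b \<in> \<Omega>'. g b = C}" using leg(1) by auto
    then have "card (set1 D h j A) \<le> card {b \<in> \<Omega>'. g b = C}" using fin by (intro card_mono) auto
    then show "card {a \<in> \<Omega>. f a = C} \<le> card {b \<in> \<Omega>'. g b = C}" using leg(2) by (simp add: A_def)
  next
    \<comment> \<open>The reverse inequality comes from a round in which Spoiler chooses his set on
      the second side.\<close>
    define A where "A = {b \<in> \<Omega>'. g b = C}"
    have A: "A \<subseteq> \<Omega>'" by (auto simp: A_def)
    have leg: "set2 D h j A \<subseteq> \<Omega>" "card (set2 D h j A) = card A"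
      "\<forall>a\<in>set2 D h j A. point2 D h j A a \<in> A"
      using conjunct2[OF legal[unfolded legal_after_def], THEN spec, THEN mp, OF j', THEN spec, THEN mp, OF A]
      by simp_all
    have "f a = C" if a: "a \<in> set2 D h j A" for a
    proof -
      have "f a = g (point2 D h j A a)"
        by (rule eqI[OF plays.round2[OF Suc.prems(1) j' A a]]) (use leg a A in \<open>auto simp: fun_upd_def\<close>)
      then show ?thesis using leg(3) a by (auto simp: A_def)
    qed
    then have "set2 D h j A \<subseteq> {a \<in> \<Omega>. f a = C}" using leg(1) by auto
    then have "card (set2 D h j A) \<le> card {a \<in> \<Omega>. f a = C}" using fin by (intro card_mono) auto
    then show "card {b \<in> \<Omega>'. g b = C} \<le> card {a \<in> \<Omega>. f a = C}" using leg(2) by (simp add: A_def)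
  qed
  then have "image_mset f (mset_set \<Omega>) = image_mset g (mset_set \<Omega>')"
    by (intro multiset_eqI) (simp add: count_image_mset_set fin)
  then have "\<exists>\<beta>. bij_betw \<beta> \<Omega> \<Omega>' \<and> (\<forall>\<alpha>\<in>\<Omega>. \<forall>i<m. wl_sim n (y[i := \<alpha>]) (y'[i := \<beta> \<alpha>]))"
    unfolding image_mset_set_eq_iff[OF fin] fg .
  moreover have "wl_sim n y y'" using Suc by blast
  ultimately show ?case using wl_sim_Suc[of y' y n] l by simp
qed

lemma T_rel_eq_wl_rel: "T_rel m \<Omega> S \<Omega>' \<phi> = wl_rel"
proof
  show "wl_rel \<subseteq> T_rel m \<Omega> S \<Omega>' \<phi>"
    using duplicator_wins_if_stable[OF stable_rel_wl_rel _ m2] by (auto simp: T_rel_def wl_rel_def)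
  show "T_rel m \<Omega> S \<Omega>' \<phi> \<subseteq> wl_rel"
  proof
    fix z assume "z \<in> T_rel m \<Omega> S \<Omega>' \<phi>"
    then obtain x x' where z: "z = (x, x')" "x \<in> tuples \<Omega> m" "x' \<in> tuples \<Omega>' m"
      and "duplicator_wins (m + 1) \<Omega> S \<Omega>' \<phi> x x'" by (auto simp: T_rel_def)
    then obtain D where D: "\<And>h. h \<in> plays (m + 1) \<Omega> \<Omega>' D \<Longrightarrow> legal_after (m + 1) \<Omega> \<Omega>' D h \<and>
        winning_position S \<phi> (position_after (initial_position x x') h)"
      by (auto simp: duplicator_wins_def)
    \<comment> \<open>The empty play suffices, as the initial position already covers all pairs of
      entries.\<close>
    have "wl_sim n x x'" for n
      by (rule winning_strategy_imp_wl_sim[OF D _ plays.start])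
        (use z(2,3) tuplesD(1)[OF z(2)] tuplesD(1)[OF z(3)] ran_initial_position[of x' x] in simp_all)
    then show "z \<in> wl_rel" using z by (simp add: wl_rel_def)
  qed
qed

end


section \<open>Equivalence and full support\<close>

context wl_cc_pair
begin

sublocale left: wl_single \<Omega> S m
  by unfold_locales (rule fin)

sublocale right: wl_single \<Omega>' S' m
  by unfold_locales (rule fin)

section \<open>From an algebraic isomorphism to full support\<close>

lemma iso_rel_subset_wl_rel:
  assumes iso: "mary_algebraic_isomorphism m \<Omega> (WL m \<Omega> S) \<Omega>' (WL m \<Omega>' S') \<psi>"
    and ext: "\<forall>s\<in>S. extend_to_unions (pr2 ` WL m \<Omega> S) (two_projection (WL m \<Omega> S) \<psi>) s = \<phi> s"
  shows "mary_iso.iso_rel (WL m \<Omega> S) \<psi> \<subseteq> wl_rel"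
proof -
  interpret I: mary_iso m \<Omega> "WL m \<Omega> S" \<Omega>' "WL m \<Omega>' S'" \<psi>
    using iso m2 by unfold_locales
  have rel: "(x' ! i, x' ! j) \<in> \<phi> s"
    if r: "(x, x') \<in> I.iso_rel" and "i < m" "j < m" "s \<in> S" "(x ! i, x ! j) \<in> s" for x x' i j s
  proof -
    obtain X where X: "X \<in> WL m \<Omega> S" "x \<in> X" "x' \<in> \<psi> X" using r by (auto simp: I.iso_rel_def)
    have lx: "x \<in> tuples \<Omega> m" "length x = m" "length x' = m"
      using that(1) I.iso_rel_tuples by (auto dest: tuplesD)
    \<comment> \<open>The extension condition speaks of the first two coordinates, so coordinates
      \<open>i\<close> and \<open>j\<close> are moved there.\<close>
    define \<sigma> where "\<sigma> k = (if k = 0 then i else j)" for k :: nat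
    have \<sigma>: "\<sigma> \<in> {..<m} \<rightarrow> {..<m}" using that by (auto simp: \<sigma>_def)
    define Y where "Y = reindex \<sigma> ` X"
    have Y: "Y \<in> WL m \<Omega> S" "reindex \<sigma> x \<in> Y"
      using I.class_reindex[OF X(1) \<sigma>] X(2) by (simp_all add: Y_def)
    have nth: "reindex \<sigma> x ! 0 = x ! i" "reindex \<sigma> x ! 1 = x ! j"
      "reindex \<sigma> x' ! 0 = x' ! i" "reindex \<sigma> x' ! 1 = x' ! j"
      using lx m2 by (simp_all add: \<sigma>_def)
    \<comment> \<open>The members of \<open>Y\<close> share their initial colour, and one of them
      has its first pair in \<open>s\<close>; hence \<open>pr2 Y\<close> is one of the sets united
      in \<open>extend_to_unions\<close>.\<close>
    have "pr2 Y \<subseteq> s"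
    proof
      fix p assume "p \<in> pr2 Y"
      then obtain y where y: "y \<in> Y" "p = (y ! 0, y ! 1)" by (auto simp: pr2_def)
      have "(reindex \<sigma> x, y) \<in> left.wl_rel" using left.WL_class_eq[OF Y] y(1) by blast
      then have "compatible S id (reindex \<sigma> x) y" by (rule left.wl_relD)
      then have "(reindex \<sigma> x ! 0, reindex \<sigma> x ! 1) \<in> s \<longleftrightarrow> (y ! 0, y ! 1) \<in> s"
        using m2 lx that(4) unfolding compatible_def by auto
      then show "p \<in> s" using nth that(5) y(2) by simp
    qed
    then have "pr2 (\<psi> Y) \<subseteq> extend_to_unions (pr2 ` WL m \<Omega> S) (two_projection (WL m \<Omega> S) \<psi>) s"
      unfolding extend_to_unions_def I.two_projection_pr2[OF Y(1), symmetric] using Y(1) by blast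
    then have "pr2 (\<psi> Y) \<subseteq> \<phi> s" using ext that(4) by simp
    moreover have mem: "reindex \<sigma> x' \<in> \<psi> Y"
      unfolding Y_def I.iso_reindex[OF X(1) \<sigma>] using X(3) by blast
    have "(x' ! i, x' ! j) \<in> pr2 (\<psi> Y)"
      unfolding pr2_def by (rule image_eqI[OF _ mem]) (simp only: nth)
    ultimately show ?thesis by blast
  qed
  have "stable_rel m \<Omega> S \<Omega>' \<phi> I.iso_rel"
    unfolding stable_rel_def
  proof (intro conjI ballI)
    show "I.iso_rel \<subseteq> tuples \<Omega> m \<times> tuples \<Omega>' m" by (rule I.iso_rel_tuples)
    fix z assume "z \<in> I.iso_rel"
    then obtain x x' where z: "z = (x, x')" "(x, x') \<in> I.iso_rel" by (cases z) auto
    have l: "x \<in> tuples \<Omega> m" "length x = m" using z(2) I.iso_rel_tuples by (auto dest: tuplesD)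
    have "(x ! i, x ! j) \<in> s" if ij: "i < m" "j < m" "s \<in> S" "(x' ! i, x' ! j) \<in> \<phi> s" for i j s
    proof -
      have "(x ! i, x ! j) \<in> \<Omega> \<times> \<Omega>" using tuplesD(2)[OF l(1)] ij by simp
      then obtain t where t: "t \<in> S" "(x ! i, x ! j) \<in> t"
        using partition_on_class[OF part(1)] by blast
      have "(x' ! i, x' ! j) \<in> \<phi> t" using rel[OF z(2) ij(1,2) t] .
      moreover have "\<phi> s \<in> S'" "\<phi> t \<in> S'" using ij(3) t bij by (auto simp: bij_betw_def)
      ultimately have "\<phi> s = \<phi> t" using ij(4) partition_on_class_eq[OF part(2)] by blast
      then have "s = t" using ij(3) t bij by (auto simp: bij_betw_def inj_on_def)
      then show ?thesis using t by simp
    qed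
    moreover have "x ! i = x ! j \<longleftrightarrow> x' ! i = x' ! j" if "i < m" "j < m" for i j
      using z(2) I.iso_eq_iff that by (auto simp: I.iso_rel_def)
    ultimately have "compatible S \<phi> x x'"
      unfolding compatible_def l(2) using rel[OF z(2)] by blast
    then show "case z of (x, x') \<Rightarrow> compatible S \<phi> x x' \<and> (\<exists>\<beta>. bij_betw \<beta> \<Omega> \<Omega>' \<and>
        (\<forall>\<alpha>\<in>\<Omega>. \<forall>i<m. (x[i := \<alpha>], x'[i := \<beta> \<alpha>]) \<in> I.iso_rel))"
      using I.iso_rel_bij[OF z(2)] z(1) by simp
  qed
  then show ?thesis by (rule stable_rel_subset_wl_rel)
qed

lemma full_support_if_WL_equivalent:
  assumes "WL_equivalent m \<Omega> S \<Omega>' S' \<phi>"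
  shows "Domain wl_rel = tuples \<Omega> m" "Range wl_rel = tuples \<Omega>' m"
proof -
  obtain \<psi> where \<psi>: "mary_algebraic_isomorphism m \<Omega> (WL m \<Omega> S) \<Omega>' (WL m \<Omega>' S') \<psi>"
    "\<forall>s\<in>S. extend_to_unions (pr2 ` WL m \<Omega> S) (two_projection (WL m \<Omega> S) \<psi>) s = \<phi> s"
    using assms unfolding WL_equivalent_def by blast
  interpret I: mary_iso m \<Omega> "WL m \<Omega> S" \<Omega>' "WL m \<Omega>' S'" \<psi>
    using \<psi>(1) m2 by unfold_locales
  show "Domain wl_rel = tuples \<Omega> m" "Range wl_rel = tuples \<Omega>' m"
    using I.iso_rel_support iso_rel_subset_wl_rel[OF \<psi>] wl_relD(1,2) by blast+
qed

section \<open>From full support to an algebraic isomorphism\<close>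

lemma set_wl_colour:
  "q \<in> set_colour (wl_colour \<Omega> S n x) \<Longrightarrow> snd q \<subseteq> UNIV \<times> UNIV \<times> S"
proof (induction n arbitrary: x)
  case (Suc n)
  then show ?case by (auto simp: fin)
qed auto

text \<open>\<open>\<phi>\<close> is known to be injective only on \<open>S\<close>, so
  \<open>set_wl_colour\<close> is used to confine the relations occurring in colours to
  \<open>S\<close>.\<close>

lemma translate_colour_inj:
  assumes "map_colour (translate_atom \<phi>) (wl_colour \<Omega> S n x) = map_colour (translate_atom \<phi>) (wl_colour \<Omega> S n y)"
  shows "wl_colour \<Omega> S n x = wl_colour \<Omega> S n y"
proof (rule colour.inj_map_strong[OF _ assms])
  fix q r assume "q \<in> set_colour (wl_colour \<Omega> S n x)" "r \<in> set_colour (wl_colour \<Omega> S n y)"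
    and eq: "translate_atom \<phi> q = translate_atom \<phi> r"
  then have sub: "snd q \<subseteq> UNIV \<times> UNIV \<times> S" "snd r \<subseteq> UNIV \<times> UNIV \<times> S"
    using set_wl_colour by blast+
  have "inj_on (map_prod id (map_prod id \<phi>)) ((UNIV::nat set) \<times> (UNIV::nat set) \<times> S)"
    using bij by (intro map_prod_inj_on) (auto simp: bij_betw_def)
  then have "snd q = snd r"
    using eq sub inj_on_image_eq_iff by (fastforce simp: translate_atom_def map_prod_def split: prod.splits)
  then show "q = r" using eq by (auto simp: translate_atom_def map_prod_def prod_eq_iff split: prod.splits)
qed

text \<open>Left tuples related to the same right tuple have equal translated colours in every
  round, hence equal colours; the other direction is substitution.\<close>

lemma wl_rel_left_iff:
  assumes "(x, x') \<in> wl_rel" "y \<in> tuples \<Omega> m"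
  shows "(x, y) \<in> left.wl_rel \<longleftrightarrow> (y, x') \<in> wl_rel"
  using assms translate_colour_inj
  by (auto simp: wl_rel_def left.wl_rel_def wl_sim_def left.wl_sim_iff)

lemma wl_rel_right_iff:
  assumes "(x, x') \<in> wl_rel" "y' \<in> tuples \<Omega>' m"
  shows "(x', y') \<in> right.wl_rel \<longleftrightarrow> (x, y') \<in> wl_rel"
  using assms by (auto simp: wl_rel_def right.wl_rel_def wl_sim_def right.wl_sim_iff)

lemma wl_rel_Image_class:
  assumes "(x, x') \<in> wl_rel"
  shows "wl_rel `` (left.wl_rel `` {x}) = right.wl_rel `` {x'}"
proof (intro equalityI subsetI)
  fix z assume "z \<in> wl_rel `` (left.wl_rel `` {x})"
  then obtain y where y: "(x, y) \<in> left.wl_rel" "(y, z) \<in> wl_rel" by blast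
  then have "(y, x') \<in> wl_rel" using wl_rel_left_iff[OF assms left.wl_relD(2)[OF y(1)]] by simp
  then show "z \<in> right.wl_rel `` {x'}" using wl_rel_right_iff wl_relD(2)[OF y(2)] y(2) by blast
next
  fix z assume "z \<in> right.wl_rel `` {x'}"
  then have "(x, z) \<in> wl_rel" using wl_rel_right_iff[OF assms] right.wl_relD(2) by blast
  then show "z \<in> wl_rel `` (left.wl_rel `` {x})"
    using left.self_in_class[OF wl_relD(1)[OF assms]] by blast
qed

text \<open>Related tuples lie in corresponding classes, which gives both the injectivity of the
  class map and the equality of intersection numbers below.\<close>

lemma wl_rel_class_iff:
  assumes "(x, x') \<in> wl_rel" "X \<in> WL m \<Omega> S"
  shows "x \<in> X \<longleftrightarrow> x' \<in> wl_rel `` X"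
proof
  assume "x' \<in> wl_rel `` X"
  then obtain y where y: "y \<in> X" "(y, x') \<in> wl_rel" by blast
  then have "(y, x) \<in> left.wl_rel" using wl_rel_left_iff wl_relD(1)[OF assms(1)] assms(1) by blast
  then show "x \<in> X" using left.WL_class_eq[OF assms(2) y(1)] by blast
qed (use assms in blast)

text \<open>A full domain gives every left class a related member, so its image is a single right
  class; a full range makes the class map surjective.\<close>

lemma mary_algebraic_isomorphism_wl_rel:
  assumes supp: "Domain wl_rel = tuples \<Omega> m" "Range wl_rel = tuples \<Omega>' m"
  shows "mary_algebraic_isomorphism m \<Omega> (WL m \<Omega> S) \<Omega>' (WL m \<Omega>' S') (\<lambda>X. wl_rel `` X)"
proof -
  have pick: "\<exists>x x'. (x, x') \<in> wl_rel \<and> x \<in> X \<and> X = left.wl_rel `` {x} \<and> wl_rel `` X = right.wl_rel `` {x'}"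
    if X: "X \<in> WL m \<Omega> S" for X
  proof -
    obtain x where x: "x \<in> tuples \<Omega> m" "x \<in> X" "X = left.wl_rel `` {x}" using left.WL_classE[OF X] .
    then obtain x' where "(x, x') \<in> wl_rel" using supp(1) by blast
    then show ?thesis using x wl_rel_Image_class by metis
  qed
  have cls: "wl_rel `` X \<in> WL m \<Omega>' S'" if "X \<in> WL m \<Omega> S" for X
    using pick[OF that] right.WL_class_mem wl_relD(2) by metis
  have "inj_on (\<lambda>X. wl_rel `` X) (WL m \<Omega> S)"
  proof (rule inj_onI)
    fix X Y assume X: "X \<in> WL m \<Omega> S" and Y: "Y \<in> WL m \<Omega> S" and eq: "wl_rel `` X = wl_rel `` Y"
    obtain x x' where x: "(x, x') \<in> wl_rel" "x \<in> X" using pick[OF X] by blast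
    then have "x \<in> Y" using wl_rel_class_iff[OF x(1)] X Y eq by metis
    then show "X = Y" using x(2) X Y left.WL_class_eq by metis
  qed
  moreover have "(\<lambda>X. wl_rel `` X) ` WL m \<Omega> S = WL m \<Omega>' S'"
  proof (intro equalityI subsetI)
    fix X' assume X': "X' \<in> WL m \<Omega>' S'"
    obtain x' where x': "x' \<in> tuples \<Omega>' m" "X' = right.wl_rel `` {x'}" using right.WL_classE[OF X'] .
    then obtain x where x: "(x, x') \<in> wl_rel" using supp(2) by blast
    then show "X' \<in> (\<lambda>X. wl_rel `` X) ` WL m \<Omega> S"
      using wl_rel_Image_class[OF x] x' left.WL_class_mem[OF wl_relD(1)[OF x]] by blast
  qed (use cls in blast)
  ultimately have b: "bij_betw (\<lambda>X. wl_rel `` X) (WL m \<Omega> S) (WL m \<Omega>' S')" by (simp add: bij_betw_def)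
  have re: "wl_rel `` (reindex \<sigma> ` X) = reindex \<sigma> ` (wl_rel `` X)"
    if X: "X \<in> WL m \<Omega> S" and \<sigma>: "\<sigma> \<in> {..<m} \<rightarrow> {..<m}" for X \<sigma>
  proof -
    obtain x x' where x: "(x, x') \<in> wl_rel" "X = left.wl_rel `` {x}" "wl_rel `` X = right.wl_rel `` {x'}"
      using pick[OF X] by blast
    have "wl_rel `` (reindex \<sigma> ` X) = right.wl_rel `` {reindex \<sigma> x'}"
      unfolding x(2) left.reindex_WL_class[OF wl_relD(1)[OF x(1)] \<sigma>]
      by (rule wl_rel_Image_class[OF wl_rel_reindex[OF x(1) \<sigma>]])
    then show ?thesis unfolding x(3) right.reindex_WL_class[OF wl_relD(2)[OF x(1)] \<sigma>] .
  qed
  have num: "mary_intersection_number \<Omega> X\<^sub>0 Xs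
      = mary_intersection_number \<Omega>' (wl_rel `` X\<^sub>0) (map (\<lambda>X. wl_rel `` X) Xs)"
    if X0: "X\<^sub>0 \<in> WL m \<Omega> S" and Xs: "Xs \<in> tuples (WL m \<Omega> S) m" for X\<^sub>0 Xs
  proof -
    obtain x x' where x: "(x, x') \<in> wl_rel" "x \<in> X\<^sub>0" using pick[OF X0] by blast
    then have x': "x' \<in> wl_rel `` X\<^sub>0" by blast
    have Xs': "map (\<lambda>X. wl_rel `` X) Xs \<in> tuples (WL m \<Omega>' S') m"
      using Xs cls by (auto simp: tuples_def)
    obtain \<beta> where \<beta>: "bij_betw \<beta> \<Omega> \<Omega>'"
      "\<And>\<alpha> i. \<alpha> \<in> \<Omega> \<Longrightarrow> i < m \<Longrightarrow> (x[i := \<alpha>], x'[i := \<beta> \<alpha>]) \<in> wl_rel"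
      using stable_rel_bij[OF stable_rel_wl_rel x(1)] by metis
    have iff: "x[i := \<alpha>] \<in> Xs ! i \<longleftrightarrow> x'[i := \<beta> \<alpha>] \<in> wl_rel `` (Xs ! i)"
      if "\<alpha> \<in> \<Omega>" "i < m" for \<alpha> i
      by (rule wl_rel_class_iff[OF \<beta>(2)[OF that] tuplesD(2)[OF Xs that(2)]])
    have "bij_betw \<beta> {\<alpha> \<in> \<Omega>. \<forall>i<m. x[i := \<alpha>] \<in> Xs ! i}
        {\<alpha> \<in> \<Omega>'. \<forall>i<m. x'[i := \<alpha>] \<in> wl_rel `` (Xs ! i)}"
      using iff by (intro bij_betw_Collect[OF \<beta>(1)]) blast
    from bij_betw_same_card[OF this]
    have "extension_count \<Omega> Xs x = extension_count \<Omega>' (map (\<lambda>X. wl_rel `` X) Xs) x'"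
      unfolding extension_count_def using tuplesD(1)[OF Xs] by (simp del: Image_iff cong: conj_cong)
    then show ?thesis
      using mary_intersection_number_eq[OF left.mary_coherent_configuration_WL X0 Xs x(2)]
        mary_intersection_number_eq[OF right.mary_coherent_configuration_WL cls[OF X0] Xs' x'] by simp
  qed
  show ?thesis unfolding mary_algebraic_isomorphism_def
    by (intro conjI ballI left.mary_coherent_configuration_WL right.mary_coherent_configuration_WL b re num)
qed

lemma WL_equivalent_if_full_support:
  assumes supp: "Domain wl_rel = tuples \<Omega> m" "Range wl_rel = tuples \<Omega>' m"
  shows "WL_equivalent m \<Omega> S \<Omega>' S' \<phi>"
proof -
  interpret I: mary_iso m \<Omega> "WL m \<Omega> S" \<Omega>' "WL m \<Omega>' S'" "\<lambda>X. wl_rel `` X"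
    using mary_algebraic_isomorphism_wl_rel[OF supp] m2 by unfold_locales
  have comp: "(x ! 0, x ! 1) \<in> s \<longleftrightarrow> (x' ! 0, x' ! 1) \<in> \<phi> s"
    if "(x, x') \<in> wl_rel" "s \<in> S" for x x' s
    using compatible_rel[OF wl_relD(5)[OF that(1)] _ _ that(2), of 0 1] wl_relD(3)[OF that(1)] m2 by simp
  have "extend_to_unions (pr2 ` WL m \<Omega> S) (two_projection (WL m \<Omega> S) (\<lambda>X. wl_rel `` X)) s = \<phi> s"
    if s: "s \<in> S" for s
  proof -
    have "extend_to_unions (pr2 ` WL m \<Omega> S) (two_projection (WL m \<Omega> S) (\<lambda>X. wl_rel `` X)) s
        = \<Union>{pr2 (wl_rel `` X) | X. X \<in> WL m \<Omega> S \<and> pr2 X \<subseteq> s}"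
      unfolding extend_to_unions_def using I.two_projection_pr2 by auto
    also have "\<dots> = \<phi> s"
    proof (intro equalityI subsetI)
      fix p assume "p \<in> \<Union>{pr2 (wl_rel `` X) | X. X \<in> WL m \<Omega> S \<and> pr2 X \<subseteq> s}"
      then obtain X x x' where "pr2 X \<subseteq> s" "x \<in> X" "(x, x') \<in> wl_rel" "p = (x' ! 0, x' ! 1)"
        by (auto simp: pr2_def)
      then show "p \<in> \<phi> s" using comp[OF _ s] by (auto simp: pr2_def)
    next
      fix p assume p: "p \<in> \<phi> s"
      have "\<phi> s \<in> S'" using s bij by (auto simp: bij_betw_def)
      then have "p \<in> \<Omega>' \<times> \<Omega>'" unfolding partition_onD1[OF part(2)] using p by (rule UnionI)
      then obtain a b where ab: "p = (a, b)" "a \<in> \<Omega>'" "b \<in> \<Omega>'" by (elim SigmaE)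
      \<comment> \<open>The pair \<open>p\<close> is made the first two entries of a tuple, so that
        full range supplies a related tuple \<open>x\<close> on the first side.\<close>
      define x' where "x' = a # replicate (m - 1) b"
      have "x' \<in> tuples \<Omega>' m" using ab m2 by (auto simp: x'_def tuples_def)
      then obtain x where x: "(x, x') \<in> wl_rel" using supp(2) by blast
      have px: "p = (x' ! 0, x' ! 1)" using ab m2 by (simp add: x'_def nth_Cons')
      define X where "X = left.wl_rel `` {x}"
      have X: "X \<in> WL m \<Omega> S" "x \<in> X"
        using left.WL_class_mem left.self_in_class wl_relD(1)[OF x] by (auto simp: X_def)
      \<comment> \<open>Every member of the class of \<open>x\<close> is also related to
        \<open>x'\<close>, so compatibility pulls \<open>p\<close> back from \<open>\<phi> s\<close>
        to \<open>s\<close> for the whole class.\<close>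
      have "(y ! 0, y ! 1) \<in> s" if "y \<in> X" for y
      proof -
        have "(x, y) \<in> left.wl_rel" using that by (simp add: X_def)
        then have "(y, x') \<in> wl_rel" using wl_rel_left_iff[OF x] left.wl_relD(2) by blast
        then show ?thesis using comp[OF _ s] p px by simp
      qed
      then have "pr2 X \<subseteq> s" by (auto simp: pr2_def)
      moreover have "p \<in> pr2 (wl_rel `` X)" unfolding pr2_def px using x X(2) by blast
      ultimately show "p \<in> \<Union>{pr2 (wl_rel `` X) | X. X \<in> WL m \<Omega> S \<and> pr2 X \<subseteq> s}" using X(1) by blast
    qed
    finally show ?thesis .
  qed
  then show ?thesis unfolding WL_equivalent_def
    by (intro exI[of _ "\<lambda>X. wl_rel `` X"] conjI ballI I.iso)
qed

end

theorem theorem3p3: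
  fixes \<Omega> :: "'a set" and S :: "('a \<times> 'a) set set"
    and \<Omega>' :: "'b set" and S' :: "('b \<times> 'b) set set"
    and m :: nat
    and \<phi> :: "('a \<times> 'a) set \<Rightarrow> ('b \<times> 'b) set"
  assumes "coherent_configuration \<Omega> S"
    and "coherent_configuration \<Omega>' S'"
    and "m \<ge> 2"
    and "algebraic_isomorphism \<Omega> S \<Omega>' S' \<phi>"
  shows "WL_equivalent m \<Omega> S \<Omega>' S' \<phi> \<longleftrightarrow>
    Domain (T_rel m \<Omega> S \<Omega>' \<phi>) = tuples \<Omega> m \<and>
    Range (T_rel m \<Omega> S \<Omega>' \<phi>) = tuples \<Omega>' m"
proof -
  interpret wl_cc_pair \<Omega> S \<Omega>' S' m \<phi>
    using assms by unfold_locales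
      (auto simp: coherent_configuration_def algebraic_isomorphism_def)
  show ?thesis
    unfolding T_rel_eq_wl_rel
    using full_support_if_WL_equivalent WL_equivalent_if_full_support by blast
qed

end
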